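(* Let $E$ be a Hausdorff locally convex space, $U\subseteq\mathbb R^n$ be an open subset, $K\subseteq\mathbb R^m$ be a convex, compact subset with nonempty interior, and $k,l\in\mathbb N_0\cup\{\infty\}$. Let $\mathcal W_1\subseteq C^k(U,[0,\infty))$ be a set of weights on $U$ which satisfies the $o$-condition and such that for each $f\in\mathcal W_1$ and $\alpha\in\mathbb N_0^n$ with $|\alpha|\le k$ there exists $g\in\mathcal W_1$ with $\left|\frac{\partial^\alpha}{\partial x^\alpha}f(x)\right|\le g(x)$ for all $x\in U$. Let $\mathcal W_2$ be a set of weights on $K$ such that (i) there is a weight $h_K\in\mathcal W_2$ with $\inf_{y\in K}h_K(y)>0$, (ii) each weight $h\in\mathcal W_2$ is bounded on $K$. Then the linear map $$\Psi:C^k_{\mathcal W_1}(U,C^l_{\mathcal W_2}(K,E))\to C^l_{\mathcal W_2}(K,C^k_{\mathcal W_1}(U,E)),\quad\Psi(\gamma):=\big(y\mapsto(x\mapsto\gamma(x)(y))\big)$$ is a homeomorphism.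
   Context: Topological vector spaces are over $\mathbb K\in\{\mathbb R,\mathbb C\}$; $\mathcal P_E$ is the set of all continuous seminorms on a locally convex space $E$; $\mathbb N_0=\{0,1,2,\dots\}$. For $U\subseteq\mathbb R^n$ open and $E$ Hausdorff locally convex, $C^k(U,E)$ is the space of continuous maps $\gamma:U\to E$ all of whose iterated partial derivatives $\frac{\partial^\alpha}{\partial x^\alpha}\gamma:U\to E$ with $|\alpha|\le k$ exist and are continuous. For a convex compact $K\subseteq\mathbb R^m$ with interior $K^\circ\ne\emptyset$ (so $K^\circ$ is dense in $K$), $C^l(K,E)$ is the space of continuous $\gamma:K\to E$ such that $\gamma|_{K^\circ}$ is $C^l$ and each $\frac{\partial^\beta}{\partial y^\beta}(\gamma|_{K^\circ})$, $|\beta|\le l$, has a (unique) continuous extension $\frac{\partial^\beta}{\partial y^\beta}\gamma:K\to E$. $C^k(U,[0,\infty))$ denotes the real-valued $C^k$-functions with values in $[0,\infty)$. A set of weights on a Hausdorff space $X$ is a nonempty set $\mathcal W$ of functions $f:X\to[0,\infty)$ such that for each $x\in X$ there is $f_x\in\mathcal W$ with $f_x(x)>0$. For $f,g:X\to[0,\infty)$, $f=o(g)$ means: for each $\varepsilon>0$ there is a compact $K_\varepsilon\subseteq X$ with $f\le\varepsilon g$ on $X\setminus K_\varepsilon$. $\mathcal W$ satisfies the $o$-condition if for each $f\in\mathcal W$ there is $g\in\mathcal W$ with $f=o(g)$. For $S=U$ or $S=K$ and a set of weights $\mathcal W$ on $S$, $C^k_{\mathcal W}(S,E)$ is the space of all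 $\gamma\in C^k(S,E)$ with $\|\gamma\|_{f,\alpha,q}:=\sup_{x\in S}f(x)q(\frac{\partial^\alpha}{\partial x^\alpha}\gamma(x))<\infty$ for all $f\in\mathcal W$, $q\in\mathcal P_E$, $|\alpha|\le k$, with the (Hausdorff) locally convex topology defined by these seminorms. *)

theory Defs
  imports "HOL-Analysis.Analysis" "HOL-Library.Function_Algebras" "HOL-Library.Extended_Nat"
begin

(* Scalars are a type of class real_normed_field. By the Gelfand-Mazur theorem, up to
   isometric isomorphism the only instances are the real and the complex numbers.
   The underlying vector space of a locally convex space is the set topspace T, a linear
   subspace of the type; this way spaces of functions are again covered. *)
locale locally_convex_space = vector_space smul
  for smul :: "'k::real_normed_field \<Rightarrow> 'e::ab_group_add \<Rightarrow> 'e" +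
  fixes T :: "'e topology"
  assumes subspace_topspace: "subspace (topspace T)"
    and continuous_add: "continuous_map (prod_topology T T) T (\<lambda>(x, y). x + y)"
    and continuous_scale: "continuous_map (prod_topology euclidean T) T (\<lambda>(c, x). smul c x)"
    and locally_convex: "\<And>N. openin T N \<Longrightarrow> 0 \<in> N \<Longrightarrow>
      \<exists>C\<subseteq>N. openin T C \<and> 0 \<in> C \<and>
        (\<forall>x\<in>C. \<forall>y\<in>C. \<forall>t\<in>{0..1}. smul (of_real (1 - t)) x + smul (of_real t) y \<in> C)"

definition continuous_seminorms ::
  "('k::real_normed_field \<Rightarrow> 'e::ab_group_add \<Rightarrow> 'e) \<Rightarrow> 'e topology \<Rightarrow> ('e \<Rightarrow> real) set" where
  "continuous_seminorms smul T = {q.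
     (\<forall>x\<in>topspace T. 0 \<le> q x) \<and>
     (\<forall>x\<in>topspace T. \<forall>y\<in>topspace T. q (x + y) \<le> q x + q y) \<and>
     (\<forall>c. \<forall>x\<in>topspace T. q (smul c x) = norm c * q x) \<and>
     continuous_map T euclideanreal q}"

definition has_partial_deriv ::
  "('k::real_normed_field \<Rightarrow> 'e::ab_group_add \<Rightarrow> 'e) \<Rightarrow> 'e topology \<Rightarrow> (real^'n) set \<Rightarrow> 'n
    \<Rightarrow> (real^'n \<Rightarrow> 'e) \<Rightarrow> (real^'n \<Rightarrow> 'e) \<Rightarrow> bool" where
  "has_partial_deriv smul T V i f g \<longleftrightarrow>
     (\<forall>x\<in>V. limitin T (\<lambda>t. smul (of_real (1 / t)) (f (x + t *\<^sub>R axis i 1) - f x)) (g x) (at 0))"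

fun has_iterated_deriv ::
  "('k::real_normed_field \<Rightarrow> 'e::ab_group_add \<Rightarrow> 'e) \<Rightarrow> 'e topology \<Rightarrow> (real^'n) set \<Rightarrow> 'n list
    \<Rightarrow> (real^'n \<Rightarrow> 'e) \<Rightarrow> (real^'n \<Rightarrow> 'e) \<Rightarrow> bool" where
  "has_iterated_deriv smul T V [] f g \<longleftrightarrow> (\<forall>x\<in>V. g x = f x)"
| "has_iterated_deriv smul T V (i # is) f g \<longleftrightarrow>
     (\<exists>h. has_iterated_deriv smul T V is f h \<and> has_partial_deriv smul T V i h g)"

(* The multi-index a stands for the iterated partial derivative d_1^(a 1) ... d_n^(a n),
   coordinates being taken in increasing order. By Schwarz' theorem, existence and
   continuity of these up to order k gives the usual notion of a C^k-map. *)
definition index_list :: "('n::{finite,linorder} \<Rightarrow> nat) \<Rightarrow> 'n list" where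
  "index_list \<alpha> = concat (map (\<lambda>i. replicate (\<alpha> i) i) (sorted_list_of_set UNIV))"

definition mi_order :: "('n::finite \<Rightarrow> nat) \<Rightarrow> enat" where
  "mi_order \<alpha> = enat (\<Sum>i\<in>UNIV. \<alpha> i)"

(* g is the continuous extension to S of the derivative of f on the interior of S.
   For open S there is nothing to extend. *)
definition is_multi_deriv ::
  "('k::real_normed_field \<Rightarrow> 'e::ab_group_add \<Rightarrow> 'e) \<Rightarrow> 'e topology \<Rightarrow>
    (real, 'n::{finite,linorder}) vec set \<Rightarrow> ('n \<Rightarrow> nat) \<Rightarrow> ((real, 'n) vec \<Rightarrow> 'e) \<Rightarrow> ((real, 'n) vec \<Rightarrow> 'e) \<Rightarrow> bool" where
  "is_multi_deriv smul T S \<alpha> f g \<longleftrightarrow>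
     has_iterated_deriv smul T (interior S) (index_list \<alpha>) f g \<and>
     continuous_map (top_of_set S) T g"

(* C^k-maps on S, where S is open or is a convex compact set with nonempty interior.
   Only the values of f on S matter. *)
definition Ck_on ::
  "('k::real_normed_field \<Rightarrow> 'e::ab_group_add \<Rightarrow> 'e) \<Rightarrow> 'e topology \<Rightarrow> enat \<Rightarrow>
    (real, 'n::{finite,linorder}) vec set \<Rightarrow> ((real, 'n) vec \<Rightarrow> 'e) \<Rightarrow> bool" where
  "Ck_on smul T k S f \<longleftrightarrow>
     continuous_map (top_of_set S) T f \<and>
     (\<forall>\<alpha>. mi_order \<alpha> \<le> k \<longrightarrow> (\<exists>g. is_multi_deriv smul T S \<alpha> f g))"

(* Well defined for f with Ck_on smul T k S f and mi_order of the multi-index at most k,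
   since T is Hausdorff and the interior of S is dense in S. *)
definition multi_deriv ::
  "('k::real_normed_field \<Rightarrow> 'e::ab_group_add \<Rightarrow> 'e) \<Rightarrow> 'e topology \<Rightarrow>
    (real, 'n::{finite,linorder}) vec set \<Rightarrow> ('n \<Rightarrow> nat) \<Rightarrow> ((real, 'n) vec \<Rightarrow> 'e) \<Rightarrow> ((real, 'n) vec \<Rightarrow> 'e)" where
  "multi_deriv smul T S \<alpha> f =
     (THE g. is_multi_deriv smul T S \<alpha> f g \<and> (\<forall>x. x \<notin> S \<longrightarrow> g x = 0))"

definition set_of_weights :: "'a set \<Rightarrow> ('a \<Rightarrow> real) set \<Rightarrow> bool" where
  "set_of_weights S W \<longleftrightarrow>
     W \<noteq> {} \<and> (\<forall>f\<in>W. \<forall>x\<in>S. 0 \<le> f x) \<and> (\<forall>x\<in>S. \<exists>f\<in>W. 0 < f x)"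

definition weight_little_o ::
  "'a::topological_space set \<Rightarrow> ('a \<Rightarrow> real) \<Rightarrow> ('a \<Rightarrow> real) \<Rightarrow> bool" where
  "weight_little_o S f g \<longleftrightarrow>
     (\<forall>\<epsilon>>0. \<exists>C\<subseteq>S. compact C \<and> (\<forall>x\<in>S - C. f x \<le> \<epsilon> * g x))"

definition o_condition :: "'a::topological_space set \<Rightarrow> ('a \<Rightarrow> real) set \<Rightarrow> bool" where
  "o_condition S W \<longleftrightarrow> (\<forall>f\<in>W. \<exists>g\<in>W. weight_little_o S f g)"

definition weighted_seminorm ::
  "('k::real_normed_field \<Rightarrow> 'e::ab_group_add \<Rightarrow> 'e) \<Rightarrow> 'e topology \<Rightarrow>
    (real, 'n::{finite,linorder}) vec set \<Rightarrow> ((real, 'n) vec \<Rightarrow> real) \<Rightarrow> ('n \<Rightarrow> nat) \<Rightarrow> ('e \<Rightarrow> real) \<Rightarrow>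
    ((real, 'n) vec \<Rightarrow> 'e) \<Rightarrow> ennreal" where
  "weighted_seminorm smul T S f \<alpha> q \<gamma> =
     (SUP x\<in>S. ennreal (f x * q (multi_deriv smul T S \<alpha> \<gamma> x)))"

(* A map on S is represented by its extension by 0, so that equality of functions is
   equality on S and the pointwise operations of the function type can be used. *)
definition weighted_Ck ::
  "('k::real_normed_field \<Rightarrow> 'e::ab_group_add \<Rightarrow> 'e) \<Rightarrow> 'e topology \<Rightarrow> enat \<Rightarrow>
    (real, 'n::{finite,linorder}) vec set \<Rightarrow> ((real, 'n) vec \<Rightarrow> real) set \<Rightarrow> ((real, 'n) vec \<Rightarrow> 'e) set" where
  "weighted_Ck smul T k S W = {\<gamma>. Ck_on smul T k S \<gamma> \<and> (\<forall>x. x \<notin> S \<longrightarrow> \<gamma> x = 0) \<and>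
     (\<forall>f\<in>W. \<forall>q\<in>continuous_seminorms smul T. \<forall>\<alpha>. mi_order \<alpha> \<le> k \<longrightarrow>
        weighted_seminorm smul T S f \<alpha> q \<gamma> < \<infinity>)}"

(* The open semi-balls form a subbase of the locally convex topology defined by the
   seminorms; for nonempty W the topspace is weighted_Ck smul T k S W. *)
definition weighted_Ck_topology ::
  "('k::real_normed_field \<Rightarrow> 'e::ab_group_add \<Rightarrow> 'e) \<Rightarrow> 'e topology \<Rightarrow> enat \<Rightarrow>
    (real, 'n::{finite,linorder}) vec set \<Rightarrow> ((real, 'n) vec \<Rightarrow> real) set \<Rightarrow> ((real, 'n) vec \<Rightarrow> 'e) topology" where
  "weighted_Ck_topology smul T k S W = topology_generated_by
     {{\<eta> \<in> weighted_Ck smul T k S W. weighted_seminorm smul T S f \<alpha> q (\<eta> - \<gamma>) < ennreal \<epsilon>}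
      | f \<alpha> q \<gamma> \<epsilon>. f \<in> W \<and> mi_order \<alpha> \<le> k \<and> q \<in> continuous_seminorms smul T \<and>
          \<gamma> \<in> weighted_Ck smul T k S W \<and> 0 < \<epsilon>}"

definition fun_scale :: "('k \<Rightarrow> 'e \<Rightarrow> 'e) \<Rightarrow> 'k \<Rightarrow> ('a \<Rightarrow> 'e) \<Rightarrow> ('a \<Rightarrow> 'e)" where
  "fun_scale smul c f = (\<lambda>x. smul c (f x))"

end

theory Submission
  imports Defs
begin

text \<open>
  Write a map \<open>\<gamma>\<close> from the first domain into the functions on the second as a function of two
  variables \<open>x\<close> and \<open>y\<close>. On either side of the exponential law membership and topology are
  governed by the same quantities, the suprema over \<open>x\<close> and \<open>y\<close> of
  \<open>f1 x * f2 y * q (\<partial>\<^sub>x\<^sup>\<alpha> \<partial>\<^sub>y\<^sup>\<beta> \<gamma> x y)\<close>. What has to be shown is that derivatives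
  which exist pointwise in one variable exist in the function space over the other variable.

  Let \<open>\<gamma>\<close> belong to the left-hand space. For fixed \<open>y\<close>, the derivative of order \<open>\<beta>\<close> at \<open>y\<close>
  is a continuous linear map on the inner function space, hence commutes with the derivatives in
  \<open>x\<close> (\<open>section_is_multi_deriv\<close>); the mixed derivatives therefore do not depend on the order of
  the two groups of variables. They are jointly continuous. The o-condition makes them small outside
  a compact set of \<open>x\<close>, and compactness makes the continuity in \<open>y\<close> uniform in \<open>x\<close>, so they
  depend continuously on \<open>y\<close> in every weighted seminorm (\<open>section_near\<close>). A mean value inequality
  for seminorms (\<open>mean_value_inequality\<close>) bounds the error of a difference quotient by the variation
  of the next derivative, so the difference quotients converge in the weighted seminorms as well
  (\<open>has_partial_deriv_section\<close>), and the flipped map lies in the right-hand space.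

  This argument uses only properties shared by both weighted domains (\<open>admissible_weights\<close>): every
  weight on the compact set is bounded, some weight is bounded away from 0, and the o-condition
  holds there with the whole set as compact subset. Exchanging the roles of the two domains yields the
  inverse map.

  The inner spaces are themselves locally convex spaces to which the definitions are applied again,
  with all their continuous seminorms rather than the defining ones only. Two facts bridge the gap:
  a continuous seminorm is bounded by finitely many defining ones (\<open>continuous_seminorm_bound\<close>), and
  the topology of any locally convex space is described by its continuous seminorms
  (\<open>neighbourhood_contains_seminorm_ball\<close>).
\<close>

section \<open>Seminorms and the mean value inequality in locally convex spaces\<close>

definition seminorm_on ::
  "('k::real_normed_field \<Rightarrow> 'e::ab_group_add \<Rightarrow> 'e) \<Rightarrow> 'e set \<Rightarrow> ('e \<Rightarrow> real) \<Rightarrow> bool" where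
  "seminorm_on smul X q \<longleftrightarrow>
     (\<forall>x\<in>X. 0 \<le> q x) \<and>
     (\<forall>x\<in>X. \<forall>y\<in>X. q (x + y) \<le> q x + q y) \<and>
     (\<forall>c. \<forall>x\<in>X. q (smul c x) = norm c * q x)"

lemma continuous_seminorms_iff:
  "q \<in> continuous_seminorms smul T \<longleftrightarrow>
     seminorm_on smul (topspace T) q \<and> continuous_map T euclideanreal q"
  by (auto simp: continuous_seminorms_def seminorm_on_def)

lemma continuous_seminormD:
  "q \<in> continuous_seminorms smul T \<Longrightarrow> seminorm_on smul (topspace T) q"
  by (simp add: continuous_seminorms_iff)

locale seminormed_subspace = vector_space smul
  for smul :: "'k::real_normed_field \<Rightarrow> 'e::ab_group_add \<Rightarrow> 'e" +
  fixes X :: "'e set" and q :: "'e \<Rightarrow> real"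
  assumes subspace_X: "subspace X" and seminorm: "seminorm_on smul X q"
begin

lemma nonneg: "x \<in> X \<Longrightarrow> 0 \<le> q x"
  and triangle: "x \<in> X \<Longrightarrow> y \<in> X \<Longrightarrow> q (x + y) \<le> q x + q y"
  and homogeneous: "x \<in> X \<Longrightarrow> q (smul c x) = norm c * q x"
  using seminorm by (auto simp: seminorm_on_def)

lemma zero [simp]: "q 0 = 0"
  using homogeneous[of 0 0] subspace_0[OF subspace_X] by simp

lemma uminus: "x \<in> X \<Longrightarrow> q (- x) = q x"
  using homogeneous[of x "-1"] by simp

lemma minus_commute: "x \<in> X \<Longrightarrow> y \<in> X \<Longrightarrow> q (x - y) = q (y - x)"
  using uminus[of "x - y"] subspace_diff[OF subspace_X] by simp

lemma triangle_diff: "x \<in> X \<Longrightarrow> y \<in> X \<Longrightarrow> q (x - y) \<le> q x + q y"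
  using triangle[of x "- y"] uminus[of y] subspace_neg[OF subspace_X] by simp

lemma triangle_via: "x \<in> X \<Longrightarrow> y \<in> X \<Longrightarrow> z \<in> X \<Longrightarrow> q (x - z) \<le> q (x - y) + q (y - z)"
  using triangle[of "x - y" "y - z"] subspace_diff[OF subspace_X] by simp

lemma reverse_triangle: "x \<in> X \<Longrightarrow> y \<in> X \<Longrightarrow> \<bar>q x - q y\<bar> \<le> q (x - y)"
  using triangle[of "x - y" y] triangle[of "y - x" x] minus_commute[of x y]
    subspace_diff[OF subspace_X] by fastforce

end

lemma atin_within_euclidean: "atin_within euclidean x S = at x within S"
  by (rule filter_eqI) (auto simp: eventually_atin_within eventually_at_topological)

context locally_convex_space
begin

lemmas topspace_0 = subspace_0[OF subspace_topspace]
  and topspace_add = subspace_add[OF subspace_topspace]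
  and topspace_diff = subspace_diff[OF subspace_topspace]
  and topspace_scale = subspace_scale[OF subspace_topspace]

lemma seminormed_subspace_topspace:
  "q \<in> continuous_seminorms smul T \<Longrightarrow> seminormed_subspace smul (topspace T) q"
  by unfold_locales (auto simp: subspace_topspace continuous_seminormD)

lemma continuous_map_add:
  assumes "continuous_map A T f" "continuous_map A T g"
  shows "continuous_map A T (\<lambda>a. f a + g a)"
  using continuous_map_compose[OF continuous_map_pairedI[OF assms] continuous_add]
  by (simp add: o_def)

lemma continuous_map_scale:
  assumes "continuous_map A euclidean c" "continuous_map A T f"
  shows "continuous_map A T (\<lambda>a. smul (c a) (f a))"
  using continuous_map_compose[OF continuous_map_pairedI[OF assms] continuous_scale]
  by (simp add: o_def)

lemma continuous_map_translate:
  assumes "a \<in> topspace T" shows "continuous_map T T (\<lambda>x. x + a)"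
  using assms by (intro continuous_map_add) auto

lemma continuous_map_scale_const: "continuous_map T T (smul c)"
  using continuous_map_scale[of T "\<lambda>_. c" "\<lambda>x. x"] by simp

lemma openin_preimage_scale: "openin T V \<Longrightarrow> openin T {x \<in> topspace T. smul c x \<in> V}"
  using continuous_map_scale_const[of c] by (simp add: continuous_map)

lemma openin_preimage_translate:
  "openin T V \<Longrightarrow> a \<in> topspace T \<Longrightarrow> openin T {x \<in> topspace T. x + a \<in> V}"
  using continuous_map_translate[of a] by (simp add: continuous_map)

lemma continuous_seminormI:
  assumes q: "seminorm_on smul (topspace T) q"
    and small: "\<And>e. 0 < e \<Longrightarrow> \<exists>V. openin T V \<and> 0 \<in> V \<and> (\<forall>x\<in>V. q x \<le> e)"
  shows "q \<in> continuous_seminorms smul T"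
proof -
  interpret q: seminormed_subspace smul "topspace T" q
    by unfold_locales (auto simp: subspace_topspace q)
  have "\<exists>V. openin T V \<and> x \<in> V \<and> (\<forall>y\<in>V. q y \<in> N)"
    if x: "x \<in> topspace T" and N: "open N" "q x \<in> N" for x N
  proof -
    obtain e where e: "0 < e" "\<And>r. dist r (q x) < e \<Longrightarrow> r \<in> N"
      using N by (auto simp: open_dist)
    obtain V where V: "openin T V" "0 \<in> V" "\<And>y. y \<in> V \<Longrightarrow> q y \<le> e / 2"
      using small[of "e / 2"] e by auto
    let ?V = "{y \<in> topspace T. y + (- x) \<in> V}"
    have "openin T ?V"
      using openin_preimage_translate[OF V(1)] subspace_neg[OF subspace_topspace x] by blast
    moreover have "q y \<in> N" if "y \<in> ?V" for y
      using that V(3)[of "y - x"] q.reverse_triangle[of y x] x e(1)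
      by (intro e(2)) (auto simp: dist_real_def)
    ultimately show ?thesis
      using x V(2) by (intro exI[of _ ?V]) auto
  qed
  note nbhd = this
  have "openin T {x \<in> topspace T. q x \<in> N}" if "open N" for N
  proof (subst openin_subopen, intro ballI)
    fix x assume "x \<in> {x \<in> topspace T. q x \<in> N}"
    then obtain V where V: "openin T V" "x \<in> V" "\<forall>y\<in>V. q y \<in> N"
      using nbhd[of x N] \<open>open N\<close> by blast
    with openin_subset[OF V(1)]
    show "\<exists>V. openin T V \<and> x \<in> V \<and> V \<subseteq> {x \<in> topspace T. q x \<in> N}"
      by (intro exI[of _ V]) blast
  qed
  then have "continuous_map T euclideanreal q"
    unfolding continuous_map by auto
  with q show ?thesis by (simp add: continuous_seminorms_iff)
qed

text \<open>A convex neighbourhood of 0 need not be invariant under scalars of norm 1, so it is first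
  shrunk to its balanced core, which is still convex and, by joint continuity of the scalar
  multiplication at (0, 0), still a neighbourhood. The seminorm is the Minkowski functional of
  the core.\<close>

lemma neighbourhood_contains_seminorm_ball:
  assumes N: "openin T N" "0 \<in> N"
  obtains q where "q \<in> continuous_seminorms smul T" "\<And>x. x \<in> topspace T \<Longrightarrow> q x < 1 \<Longrightarrow> x \<in> N"
proof -
  obtain C where C: "C \<subseteq> N" "openin T C" "0 \<in> C" and conv: "\<And>x y t. x \<in> C \<Longrightarrow> y \<in> C \<Longrightarrow>
      t \<in> {0..1} \<Longrightarrow> smul (of_real (1 - t)) x + smul (of_real t) y \<in> C"
    using locally_convex[OF N] by blast
  \<comment> \<open>the balanced core of \<open>C\<close>\<close>
  define B where "B = {x \<in> topspace T. \<forall>c. norm c \<le> 1 \<longrightarrow> smul c x \<in> C}"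
  have B_conv: "smul (of_real (1 - t)) x + smul (of_real t) y \<in> B"
    if "x \<in> B" "y \<in> B" "t \<in> {0..1}" for x y t
  proof -
    have "smul c (smul (of_real (1 - t)) x + smul (of_real t) y) \<in> C" if "norm c \<le> 1" for c
      using conv[of "smul c x" "smul c y" t] \<open>x \<in> B\<close> \<open>y \<in> B\<close> \<open>t \<in> {0..1}\<close> that
      by (simp add: B_def scale_right_distrib mult.commute del: of_real_diff)
    then show ?thesis
      using that unfolding B_def by (auto intro!: topspace_add topspace_scale)
  qed
  have B_bal: "smul c x \<in> B" if "x \<in> B" "norm c \<le> 1" for c x
  proof -
    have "smul d (smul c x) \<in> C" if "norm d \<le> 1" for d
      using \<open>x \<in> B\<close> \<open>norm c \<le> 1\<close> that mult_le_one[of "norm d" "norm c"]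
      by (auto simp: B_def norm_mult)
    then show ?thesis using that by (auto simp: B_def topspace_scale)
  qed
  define Z where "Z = {z \<in> topspace (prod_topology (euclidean :: 'k topology) T).
      (case z of (c, x) \<Rightarrow> smul c x) \<in> C}"
  have "openin (prod_topology euclidean T) Z"
    unfolding Z_def using continuous_scale C(2) by (rule openin_continuous_map_preimage)
  moreover have "(0, 0) \<in> Z"
    using C by (simp add: Z_def topspace_0)
  ultimately obtain A V where "openin euclidean A" and A0: "0 \<in> A" and V: "openin T V" "0 \<in> V"
    and AV: "A \<times> V \<subseteq> Z"
    unfolding openin_prod_topology_alt by meson
  then have A: "open A" "0 \<in> A" by auto
  obtain d where d: "0 < d" "\<And>c. norm c \<le> d \<Longrightarrow> c \<in> A"
    using A by (force simp: open_contains_cball)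
  define V' where "V' = {x \<in> topspace T. smul (of_real (1 / d)) x \<in> V}"
  have V': "openin T V'" "0 \<in> V'"
    using V openin_preimage_scale[OF V(1)] topspace_0 by (auto simp: V'_def)
  have V'B: "V' \<subseteq> B"
  proof
    fix x assume x: "x \<in> V'"
    have "smul c x \<in> C" if "norm c \<le> 1" for c
    proof -
      have "(c * of_real d, smul (of_real (1 / d)) x) \<in> A \<times> V"
        using x d that by (auto simp: V'_def norm_mult intro!: d(2) mult_left_le_one_le)
      then have "smul (c * of_real d) (smul (of_real (1 / d)) x) \<in> C"
        using AV by (auto simp: Z_def)
      then show ?thesis using d(1) by (simp flip: of_real_mult add: mult.assoc)
    qed
    then show "x \<in> B" using x by (auto simp: B_def V'_def)
  qed
  \<comment> \<open>the admissible scaling factors in the Minkowski functional of the core\<close>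
  define M where "M x = {t. 0 < t \<and> smul (of_real (1 / t)) x \<in> B}" for x
  define q where "q x = Inf (M x)" for x
  have M_pos: "t \<in> M x \<Longrightarrow> 0 < t" for t x by (simp add: M_def)
  have bdd: "bdd_below (M x)" for x
    by (rule bdd_belowI[of _ 0]) (use M_pos less_imp_le in blast)
  have M_up: "s \<in> M x" if "t \<in> M x" "t \<le> s" for s t x
  proof -
    have "smul (of_real (t / s)) (smul (of_real (1 / t)) x) \<in> B"
      using that M_pos[OF that(1)] by - (rule B_bal, auto simp: M_def simp del: of_real_divide)
    moreover have "t / s * (1 / t) = 1 / s" using M_pos[OF that(1)] by simp
    ultimately show ?thesis
      using that M_pos[OF that(1)] unfolding M_def scale_scale of_real_mult[symmetric] by simp
  qed
  have M_ne: "M x \<noteq> {}" if x: "x \<in> topspace T" for x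
  proof -
    have "continuous_map euclideanreal T (\<lambda>s. smul (of_real s) x)"
      by (rule continuous_map_scale) (auto simp: x intro!: continuous_intros)
    from openin_continuous_map_preimage[OF this V'(1)]
    have "open {s. smul (of_real s) x \<in> V'}" by simp
    moreover have "0 \<in> {s. smul (of_real s) x \<in> V'}" using V'(2) by simp
    ultimately obtain e where "0 < e" and ball: "cball 0 e \<subseteq> {s. smul (of_real s) x \<in> V'}"
      by (meson open_contains_cball)
    then have e: "0 < e" "\<bar>s\<bar> \<le> e \<Longrightarrow> smul (of_real s) x \<in> V'" for s
      using subsetD[OF ball, of s] by auto
    have "1 / e \<in> M x" using e V'B by (auto simp: M_def)
    then show ?thesis by blast
  qed
  have q_le: "t \<in> M x \<Longrightarrow> q x \<le> t" for t x
    unfolding q_def by (rule cInf_lower[OF _ bdd])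
  have M_of_less: "t \<in> M x" if "x \<in> topspace T" "q x < t" for t x
    using cInf_lessD[OF M_ne[OF that(1)], of t] that(2) M_up by (auto simp: q_def less_imp_le)
  have q_nonneg: "0 \<le> q x" if "x \<in> topspace T" for x
    unfolding q_def using M_ne[OF that] M_pos less_imp_le by (blast intro: cInf_greatest)
  have q_tri: "q (x + y) \<le> q x + q y" if x: "x \<in> topspace T" and y: "y \<in> topspace T" for x y
  proof (rule field_le_epsilon)
    fix e :: real assume e: "0 < e"
    define s t where "s = q x + e / 2" and "t = q y + e / 2"
    have st: "s \<in> M x" "t \<in> M y"
      using M_of_less x y e by (auto simp: s_def t_def)
    then have pos: "0 < s" "0 < t" using M_pos by auto
    have eq: "1 - t / (s + t) = s / (s + t)" using pos by (simp add: field_simps)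
    have "smul (of_real (1 - t / (s + t))) (smul (of_real (1 / s)) x)
        + smul (of_real (t / (s + t))) (smul (of_real (1 / t)) y) \<in> B"
      using st pos by - (rule B_conv, auto simp: M_def)
    then have "smul (of_real (1 / (s + t))) (x + y) \<in> B"
      unfolding eq using pos by (simp add: scale_right_distrib flip: of_real_mult)
    then have "s + t \<in> M (x + y)" using pos by (simp add: M_def)
    from q_le[OF this] show "q (x + y) \<le> q x + q y + e" by (simp add: s_def t_def)
  qed
  have q_scale_le: "q (smul c x) \<le> norm c * q x" if x: "x \<in> topspace T" and c: "c \<noteq> 0" for c x
  proof (rule field_le_epsilon)
    fix e :: real assume e: "0 < e"
    define t where "t = q x + e / norm c"
    have t: "t \<in> M x" "0 < t"
      using M_of_less[OF x, of t] M_pos[of t x] e c by (auto simp: t_def)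
    have "smul (c / of_real (norm c)) (smul (of_real (1 / t)) x) \<in> B"
      using t c by - (rule B_bal, auto simp: M_def norm_divide)
    then have "smul (of_real (1 / (norm c * t))) (smul c x) \<in> B"
      using t c by (simp add: field_simps)
    then have "norm c * t \<in> M (smul c x)" using t c by (simp add: M_def)
    from q_le[OF this] show "q (smul c x) \<le> norm c * q x + e"
      using c by (simp add: t_def algebra_simps)
  qed
  have q_scale: "q (smul c x) = norm c * q x" if x: "x \<in> topspace T" for c x
  proof (cases "c = 0")
    case True
    have "q 0 \<le> e" if "0 < e" for e
      using that V'(2) V'B by (intro q_le) (auto simp: M_def)
    then have "q 0 \<le> 0" using field_le_epsilon[of "q 0" 0] by simp
    then have "q 0 = 0" using q_nonneg[OF topspace_0] by simp
    with True show ?thesis by simp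
  next
    case False
    have "q x \<le> norm (inverse c) * q (smul c x)"
      using q_scale_le[of "smul c x" "inverse c"] False x by (simp add: topspace_scale)
    then have "q x \<le> q (smul c x) / norm c" by (simp add: norm_inverse divide_inverse mult.commute)
    then have "norm c * q x \<le> q (smul c x)"
      using False by (simp add: pos_le_divide_eq mult.commute)
    with q_scale_le[OF x False] show ?thesis by simp
  qed
  have "q \<in> continuous_seminorms smul T"
  proof (rule continuous_seminormI)
    show "seminorm_on smul (topspace T) q"
      by (simp add: seminorm_on_def q_nonneg q_tri q_scale)
    fix e :: real assume e: "0 < e"
    let ?V = "{x \<in> topspace T. smul (of_real (1 / e)) x \<in> V'}"
    have "q x \<le> e" if "x \<in> ?V" for x
      using that e V'B by (intro q_le) (auto simp: M_def)
    then show "\<exists>V. openin T V \<and> 0 \<in> V \<and> (\<forall>x\<in>V. q x \<le> e)"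
      using openin_preimage_scale[OF V'(1)] V'(2) topspace_0 by (intro exI[of _ ?V]) auto
  qed
  moreover have "x \<in> N" if "x \<in> topspace T" "q x < 1" for x
  proof -
    have "x \<in> B" using M_of_less[OF that] by (simp add: M_def)
    then have "smul 1 x \<in> C" unfolding B_def by (metis (mono_tags, lifting) mem_Collect_eq norm_one order_refl)
    then show ?thesis using C by auto
  qed
  ultimately show ?thesis using that by blast
qed

text \<open>Convergence in the topology of a locally convex space is tested by real limits, which is
  how all later estimates enter.\<close>

lemma limitin_iff_seminorms:
  "limitin T g l F \<longleftrightarrow> l \<in> topspace T \<and> (\<forall>\<^sub>F t in F. g t \<in> topspace T) \<and>
     (\<forall>q\<in>continuous_seminorms smul T. ((\<lambda>t. q (g t - l)) \<longlongrightarrow> 0) F)"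
proof (intro iffI conjI ballI)
  assume lim: "limitin T g l F"
  then show l: "l \<in> topspace T" by (rule limitin_topspace)
  show ev: "\<forall>\<^sub>F t in F. g t \<in> topspace T"
    using lim l by (auto simp: limitin_def)
  fix q assume q: "q \<in> continuous_seminorms smul T"
  interpret q: seminormed_subspace smul "topspace T" q
    by (rule seminormed_subspace_topspace[OF q])
  show "((\<lambda>t. q (g t - l)) \<longlongrightarrow> 0) F"
  proof (rule tendstoI)
    fix e :: real assume e: "0 < e"
    have "continuous_map T euclideanreal (\<lambda>x. q (x + (- l)))"
      using continuous_map_compose[OF continuous_map_translate, of "- l" euclideanreal q] q l
      by (simp add: o_def continuous_seminorms_iff subspace_neg[OF subspace_topspace])
    then have "openin T {x \<in> topspace T. q (x + (- l)) \<in> {..<e}}"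
      unfolding continuous_map open_openin[symmetric] using open_lessThan by blast
    then have "\<forall>\<^sub>F t in F. g t \<in> {x \<in> topspace T. q (x + (- l)) \<in> {..<e}}"
      using lim l e unfolding limitin_def by (auto dest!: spec[of _ "{x \<in> topspace T. q (x + (- l)) \<in> {..<e}}"])
    then show "\<forall>\<^sub>F t in F. dist (q (g t - l)) 0 < e"
      by eventually_elim (use l in \<open>auto simp: q.nonneg topspace_diff\<close>)
  qed
next
  assume rhs: "l \<in> topspace T \<and> (\<forall>\<^sub>F t in F. g t \<in> topspace T) \<and>
     (\<forall>q\<in>continuous_seminorms smul T. ((\<lambda>t. q (g t - l)) \<longlongrightarrow> 0) F)"
  then have l: "l \<in> topspace T" by simp
  show "limitin T g l F"
    unfolding limitin_def
  proof (intro conjI allI impI)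
    show "l \<in> topspace T" by (rule l)
    fix N assume N: "openin T N \<and> l \<in> N"
    have "openin T {x \<in> topspace T. x + l \<in> N}"
      using N l by (intro openin_preimage_translate) auto
    then obtain q where q: "q \<in> continuous_seminorms smul T"
      and ball: "\<And>x. x \<in> topspace T \<Longrightarrow> q x < 1 \<Longrightarrow> x + l \<in> N"
      using neighbourhood_contains_seminorm_ball[of "{x \<in> topspace T. x + l \<in> N}"] N topspace_0
      by (metis (no_types, lifting) add_0 mem_Collect_eq)
    have "\<forall>\<^sub>F t in F. q (g t - l) < 1"
      using rhs q by (intro order_tendstoD(2)[of _ 0]) auto
    moreover have "\<forall>\<^sub>F t in F. g t \<in> topspace T" using rhs by blast
    ultimately show "\<forall>\<^sub>F t in F. g t \<in> N"
      by eventually_elim (use ball l topspace_diff in fastforce)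
  qed
qed

lemma limitin_add:
  assumes "limitin T f a F" "limitin T g b F"
  shows "limitin T (\<lambda>t. f t + g t) (a + b) F"
proof -
  have "((\<lambda>t. q (f t + g t - (a + b))) \<longlongrightarrow> 0) F" if q: "q \<in> continuous_seminorms smul T" for q
  proof -
    interpret q: seminormed_subspace smul "topspace T" q
      by (rule seminormed_subspace_topspace[OF q])
    have lim: "((\<lambda>t. q (f t - a) + q (g t - b)) \<longlongrightarrow> 0) F"
      using assms q by (auto simp: limitin_iff_seminorms intro!: tendsto_add_zero)
    have "\<forall>\<^sub>F t in F. f t \<in> topspace T" "\<forall>\<^sub>F t in F. g t \<in> topspace T"
      "a \<in> topspace T" "b \<in> topspace T"
      using assms by (auto simp: limitin_iff_seminorms)
    then have "\<forall>\<^sub>F t in F. norm (q (f t + g t - (a + b))) \<le> q (f t - a) + q (g t - b)"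
      by - (erule (1) eventually_elim2, simp add: add_diff_add q.nonneg topspace_add topspace_diff q.triangle)
    then show ?thesis by (rule Lim_null_comparison[OF _ lim])
  qed
  moreover have "\<forall>\<^sub>F t in F. f t + g t \<in> topspace T"
    using assms by (auto simp: limitin_iff_seminorms intro: topspace_add elim: eventually_elim2)
  ultimately show ?thesis
    using assms by (auto simp: limitin_iff_seminorms topspace_add)
qed

lemma continuous_map_top_of_set_iff:
  "continuous_map (top_of_set S) T g \<longleftrightarrow> (\<forall>x\<in>S. g x \<in> topspace T) \<and>
     (\<forall>x\<in>S. \<forall>q\<in>continuous_seminorms smul T. ((\<lambda>y. q (g y - g x)) \<longlongrightarrow> 0) (at x within S))"
proof -
  have "(\<forall>\<^sub>F t in at x within S. g t \<in> topspace T)" if "\<forall>x\<in>S. g x \<in> topspace T" for x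
    using that by (auto simp: eventually_at_filter)
  then show ?thesis
    unfolding continuous_map_atin
    by (auto simp: atin_subtopology_within atin_within_euclidean limitin_iff_seminorms)
qed

text \<open>A vector-valued curve has no intermediate point as in the scalar mean value theorem, but the
  estimate survives in every seminorm. It says that the curve stays close to its linear
  approximation with slope c as long as its derivative stays close to c. The estimate holds on
  all short intervals around a given point up to an error e, it is additive under joining
  intervals, and so bisection extends it to the whole interval.\<close>

lemma mean_value_inequality:
  fixes f f' :: "real \<Rightarrow> 'e"
  assumes q: "q \<in> continuous_seminorms smul T" and "a \<le> b"
    and f: "\<And>t. t \<in> {a..b} \<Longrightarrow> f t \<in> topspace T" and c: "c \<in> topspace T"
    and deriv: "\<And>t. t \<in> {a..b} \<Longrightarrow>
      limitin T (\<lambda>h. smul (of_real (1 / h)) (f (t + h) - f t)) (f' t) (at 0)"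
    and bound: "\<And>t. t \<in> {a..b} \<Longrightarrow> q (f' t - c) \<le> M"
  shows "q (f b - f a - smul (of_real (b - a)) c) \<le> M * (b - a)"
proof -
  interpret q: seminormed_subspace smul "topspace T" q
    by (rule seminormed_subspace_topspace[OF q])
  note mem = topspace_add topspace_diff topspace_scale f c
  have gap: "f v - f u - smul (of_real (v - u)) c
      = (f v - f w - smul (of_real (v - w)) c) - (f u - f w - smul (of_real (u - w)) c)" for u v w
    by (simp add: scale_left_diff_distrib)
  have main: "q (f b - f a - smul (of_real (b - a)) c) \<le> (M + e) * (b - a)" if e: "0 < e" for e
  proof -
    let ?P = "\<lambda>u v. a \<le> u \<and> u \<le> v \<and> v \<le> b \<longrightarrow>
      q (f v - f u - smul (of_real (v - u)) c) \<le> (M + e) * (v - u)"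
    have "?P a b"
    proof (rule Bolzano[of a b ?P])
      show "?P u w" if "?P u v" "?P v w" "u \<le> v" "v \<le> w" for u v w
      proof
        assume *: "a \<le> u \<and> u \<le> w \<and> w \<le> b"
        have "f w - f u - smul (of_real (w - u)) c
          = (f w - f v - smul (of_real (w - v)) c) + (f v - f u - smul (of_real (v - u)) c)"
          by (simp add: scale_left_diff_distrib)
        then have "q (f w - f u - smul (of_real (w - u)) c)
          \<le> q (f w - f v - smul (of_real (w - v)) c) + q (f v - f u - smul (of_real (v - u)) c)"
          using * that(3,4) by (simp only:) (intro q.triangle mem; simp)
        also have "\<dots> \<le> (M + e) * (w - v) + (M + e) * (v - u)"
          using that * by (intro add_mono) auto
        finally show "q (f w - f u - smul (of_real (w - u)) c) \<le> (M + e) * (w - u)"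
          by (simp add: algebra_simps)
      qed
      fix x assume x: "a \<le> x" "x \<le> b"
      then have fx': "f' x \<in> topspace T"
        and lim: "((\<lambda>h. q (smul (of_real (1 / h)) (f (x + h) - f x) - f' x)) \<longlongrightarrow> 0) (at 0)"
        using deriv[of x] q by (auto simp: limitin_iff_seminorms)
      obtain d where d: "0 < d" and close: "\<And>h. h \<noteq> 0 \<Longrightarrow> \<bar>h\<bar> < d \<Longrightarrow>
          q (smul (of_real (1 / h)) (f (x + h) - f x) - f' x) < e"
        using order_tendstoD(2)[OF lim e] unfolding eventually_at
        by (metis dist_real_def UNIV_I diff_0_right)
      have local: "q (f (x + h) - f x - smul (of_real h) c) \<le> (M + e) * \<bar>h\<bar>"
        if h: "\<bar>h\<bar> < d" "x + h \<in> {a..b}" for h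
      proof (cases "h = 0")
        case False
        define r where "r = smul (of_real (1 / h)) (f (x + h) - f x) - f' x"
        have r: "r \<in> topspace T" using x h fx' by (auto simp: r_def intro!: mem)
        have eq: "f (x + h) - f x - smul (of_real h) c = smul (of_real h) (r + (f' x - c))"
          using False by (simp add: r_def scale_right_diff_distrib flip: of_real_mult)
        have "q (f (x + h) - f x - smul (of_real h) c) \<le> \<bar>h\<bar> * (q r + q (f' x - c))"
          unfolding eq using r fx' by (simp add: q.homogeneous mem mult_left_mono q.triangle)
        also have "\<dots> \<le> \<bar>h\<bar> * (e + M)"
          using close[OF False h(1)] bound[of x] x by (intro mult_left_mono) (auto simp: r_def)
        finally show ?thesis by (simp add: algebra_simps)
      qed simp
      have "?P u v" if "u \<le> x \<and> x \<le> v \<and> v - u < d" for u v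
      proof
        assume *: "a \<le> u \<and> u \<le> v \<and> v \<le> b"
        have "q (f v - f u - smul (of_real (v - u)) c)
          \<le> q (f v - f x - smul (of_real (v - x)) c) + q (f u - f x - smul (of_real (u - x)) c)"
          unfolding gap[of v u x] using that * by (intro q.triangle_diff mem) auto
        also have "\<dots> \<le> (M + e) * \<bar>v - x\<bar> + (M + e) * \<bar>u - x\<bar>"
          using local[of "v - x"] local[of "u - x"] that * by (intro add_mono) auto
        also have "\<dots> = (M + e) * (v - u)" using that by (simp add: algebra_simps)
        finally show "q (f v - f u - smul (of_real (v - u)) c) \<le> (M + e) * (v - u)" .
      qed
      then show "\<exists>d>0. \<forall>u v. u \<le> x \<and> x \<le> v \<and> v - u < d \<longrightarrow> ?P u v"
        using d by blast
    qed (rule \<open>a \<le> b\<close>)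
    then show ?thesis using \<open>a \<le> b\<close> by simp
  qed
  show ?thesis
  proof (rule field_le_epsilon)
    fix e :: real assume e: "0 < e"
    have "q (f b - f a - smul (of_real (b - a)) c) \<le> (M + e / (b - a + 1)) * (b - a)"
      using e \<open>a \<le> b\<close> by (intro main) auto
    also have "\<dots> \<le> M * (b - a) + e"
      using e \<open>a \<le> b\<close> by (simp add: field_simps)
    finally show "q (f b - f a - smul (of_real (b - a)) c) \<le> M * (b - a) + e" .
  qed
qed

end

section \<open>Topologies generated by seminorms\<close>

text \<open>The open semi-balls of the given seminorms are only a subbase, which is also how
  \<^const>\<open>weighted_Ck_topology\<close> is built.\<close>

definition seminorm_topology :: "'e::ab_group_add set \<Rightarrow> ('e \<Rightarrow> real) set \<Rightarrow> 'e topology" where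
  "seminorm_topology X P =
     topology_generated_by {{\<eta> \<in> X. p (\<eta> - \<gamma>) < \<epsilon>} | p \<gamma> \<epsilon>. p \<in> P \<and> \<gamma> \<in> X \<and> 0 < \<epsilon>}"

locale seminorm_family = vector_space smul
  for smul :: "'k::real_normed_field \<Rightarrow> 'e::ab_group_add \<Rightarrow> 'e" +
  fixes X :: "'e set" and P :: "('e \<Rightarrow> real) set"
  assumes subspace_X: "subspace X" and P_nonempty: "P \<noteq> {}"
    and seminorm_on_P: "p \<in> P \<Longrightarrow> seminorm_on smul X p"
begin

abbreviation \<tau> :: "'e topology" where "\<tau> \<equiv> seminorm_topology X P"

lemmas mem_X = subspace_0[OF subspace_X] subspace_add[OF subspace_X]
  subspace_diff[OF subspace_X] subspace_scale[OF subspace_X]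

lemma seminormed_subspace_X: "p \<in> P \<Longrightarrow> seminormed_subspace smul X p"
  by unfold_locales (auto simp: subspace_X seminorm_on_P)

lemma topspace_seminorm_topology: "topspace \<tau> = X"
proof
  show "topspace \<tau> \<subseteq> X"
    by (auto simp: seminorm_topology_def)
  obtain p where p: "p \<in> P" using P_nonempty by blast
  interpret p: seminormed_subspace smul X p by (rule seminormed_subspace_X[OF p])
  show "X \<subseteq> topspace \<tau>"
  proof
    fix x assume x: "x \<in> X"
    then have "x \<in> {\<eta> \<in> X. p (\<eta> - x) < 1}" by simp
    with p x show "x \<in> topspace \<tau>"
      unfolding seminorm_topology_def topology_generated_by_topspace
      by (intro UnionI[of "{\<eta> \<in> X. p (\<eta> - x) < 1}"]) (auto intro: zero_less_one)
  qed
qed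

lemma openin_semiball: "p \<in> P \<Longrightarrow> \<gamma> \<in> X \<Longrightarrow> openin \<tau> {\<eta> \<in> X. p (\<eta> - \<gamma>) < \<epsilon>}"
proof (cases "0 < \<epsilon>")
  case True
  assume "p \<in> P" "\<gamma> \<in> X"
  with True show ?thesis
    unfolding seminorm_topology_def by (intro topology_generated_by_Basis) blast
next
  case False
  assume p: "p \<in> P" and "\<gamma> \<in> X"
  interpret p: seminormed_subspace smul X p by (rule seminormed_subspace_X[OF p])
  have "{\<eta> \<in> X. p (\<eta> - \<gamma>) < \<epsilon>} = {}"
    using False p.nonneg[OF mem_X(3)[OF _ \<open>\<gamma> \<in> X\<close>]] by force
  then show ?thesis by (metis openin_empty)
qed

lemma openin_finite_semiball:
  assumes "finite F" "F \<subseteq> P" "\<gamma> \<in> X"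
  shows "openin \<tau> {\<eta> \<in> X. \<forall>p\<in>F. p (\<eta> - \<gamma>) < \<epsilon>}"
proof -
  have "openin \<tau> ((\<Inter>p\<in>F. {\<eta> \<in> X. p (\<eta> - \<gamma>) < \<epsilon>}) \<inter> topspace \<tau>)"
    using assms by (intro openin_INT openin_semiball) auto
  moreover have "(\<Inter>p\<in>F. {\<eta> \<in> X. p (\<eta> - \<gamma>) < \<epsilon>}) \<inter> topspace \<tau> =
      {\<eta> \<in> X. \<forall>p\<in>F. p (\<eta> - \<gamma>) < \<epsilon>}"
    by (auto simp: topspace_seminorm_topology)
  ultimately show ?thesis by simp
qed

text \<open>The subbase becomes a neighbourhood base after finite intersections: a semi-ball around any
  centre contains, by the triangle inequality, a semi-ball of the same seminorm around each of
  its points.\<close>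

lemma openin_contains_finite_semiball:
  assumes "openin \<tau> N" "\<gamma> \<in> N"
  shows "\<exists>F \<epsilon>. finite F \<and> F \<subseteq> P \<and> 0 < \<epsilon> \<and> {\<eta> \<in> X. \<forall>p\<in>F. p (\<eta> - \<gamma>) < \<epsilon>} \<subseteq> N"
proof -
  let ?S = "{{\<eta> \<in> X. p (\<eta> - \<gamma>) < \<epsilon>} | p \<gamma> \<epsilon>. p \<in> P \<and> \<gamma> \<in> X \<and> 0 < \<epsilon>}"
  have "generate_topology_on ?S N"
    using assms(1) by (simp add: seminorm_topology_def openin_topology_generated_by_iff)
  then show ?thesis using assms(2)
  proof (induction arbitrary: \<gamma>)
    case (Int A B)
    then have \<gamma>: "\<gamma> \<in> A" "\<gamma> \<in> B" by auto
    from Int.IH(1)[OF \<gamma>(1)] obtain F \<epsilon> where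
      "finite F" "F \<subseteq> P" "0 < \<epsilon>" and A: "{\<eta> \<in> X. \<forall>p\<in>F. p (\<eta> - \<gamma>) < \<epsilon>} \<subseteq> A"
      by blast
    moreover from Int.IH(2)[OF \<gamma>(2)] obtain G \<delta> where
      "finite G" "G \<subseteq> P" "0 < \<delta>" and B: "{\<eta> \<in> X. \<forall>p\<in>G. p (\<eta> - \<gamma>) < \<delta>} \<subseteq> B"
      by blast
    ultimately have "finite (F \<union> G)" "F \<union> G \<subseteq> P" "0 < min \<epsilon> \<delta>"
      "{\<eta> \<in> X. \<forall>p\<in>F \<union> G. p (\<eta> - \<gamma>) < min \<epsilon> \<delta>} \<subseteq> A \<inter> B" by auto
    then show ?case by blast
  next
    case (UN K)
    then obtain k where k: "k \<in> K" "\<gamma> \<in> k" by blast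
    from UN.IH[OF this] k(1) show ?case by (meson Union_upper order_trans)
  next
    case (Basis N)
    then obtain p c e where N: "N = {\<eta> \<in> X. p (\<eta> - c) < e}" and p: "p \<in> P" and c: "c \<in> X"
      by blast
    interpret p: seminormed_subspace smul X p by (rule seminormed_subspace_X[OF p])
    have "{\<eta> \<in> X. \<forall>p\<in>{p}. p (\<eta> - \<gamma>) < e - p (\<gamma> - c)} \<subseteq> N"
      using p.triangle_via[of _ \<gamma> c] Basis.prems c unfolding N by fastforce
    moreover have "0 < e - p (\<gamma> - c)" using Basis.prems by (simp add: N)
    ultimately show ?case using p by (intro exI[of _ "{p}"]) blast
  qed simp
qed

lemma limitin_seminorm_topology_iff:
  "limitin \<tau> g l F \<longleftrightarrow> l \<in> X \<and> (\<forall>\<^sub>F t in F. g t \<in> X) \<and> (\<forall>p\<in>P. ((\<lambda>t. p (g t - l)) \<longlongrightarrow> 0) F)"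
proof (intro iffI conjI ballI)
  assume lim: "limitin \<tau> g l F"
  show l: "l \<in> X" using limitin_topspace[OF lim] by (simp add: topspace_seminorm_topology)
  have "openin \<tau> X" using openin_topspace[of \<tau>] by (simp only: topspace_seminorm_topology)
  then show ev: "\<forall>\<^sub>F t in F. g t \<in> X"
    using lim l unfolding limitin_def by blast
  fix p assume p: "p \<in> P"
  interpret p: seminormed_subspace smul X p by (rule seminormed_subspace_X[OF p])
  show "((\<lambda>t. p (g t - l)) \<longlongrightarrow> 0) F"
  proof (rule tendstoI)
    fix e :: real assume e: "0 < e"
    have "l \<in> {\<eta> \<in> X. p (\<eta> - l) < e}" using l e by simp
    then have "\<forall>\<^sub>F t in F. g t \<in> {\<eta> \<in> X. p (\<eta> - l) < e}"
      using lim openin_semiball[OF p l, of e] unfolding limitin_def by blast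
    then show "\<forall>\<^sub>F t in F. dist (p (g t - l)) 0 < e"
      by eventually_elim (use l in \<open>auto simp: p.nonneg mem_X\<close>)
  qed
next
  assume rhs: "l \<in> X \<and> (\<forall>\<^sub>F t in F. g t \<in> X) \<and> (\<forall>p\<in>P. ((\<lambda>t. p (g t - l)) \<longlongrightarrow> 0) F)"
  show "limitin \<tau> g l F"
    unfolding limitin_def
  proof (intro conjI allI impI)
    show "l \<in> topspace \<tau>" using rhs topspace_seminorm_topology by simp
    fix N assume "openin \<tau> N \<and> l \<in> N"
    then obtain G e where G: "finite G" "G \<subseteq> P" and e: "0 < e"
      and sub: "{\<eta> \<in> X. \<forall>p\<in>G. p (\<eta> - l) < e} \<subseteq> N"
      using openin_contains_finite_semiball by meson
    have "\<forall>\<^sub>F t in F. \<forall>p\<in>G. p (g t - l) < e"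
      using rhs G e by (intro eventually_ball_finite ballI order_tendstoD(2)[of _ 0]) auto
    moreover have "\<forall>\<^sub>F t in F. g t \<in> X" using rhs by blast
    ultimately show "\<forall>\<^sub>F t in F. g t \<in> N"
      by eventually_elim (use sub in blast)
  qed
qed

text \<open>The algebraic operations are continuous because the seminorm of the error of a sum or a
  multiple is dominated by the seminorms of the errors of the operands.\<close>

lemma locally_convex_seminorm_topology: "locally_convex_space smul \<tau>"
proof
  show "subspace (topspace \<tau>)" by (simp add: topspace_seminorm_topology subspace_X)
  show "continuous_map (prod_topology \<tau> \<tau>) \<tau> (\<lambda>(x, y). x + y)"
    unfolding continuous_map_atin
  proof
    fix z assume z: "z \<in> topspace (prod_topology \<tau> \<tau>)"
    let ?F = "atin (prod_topology \<tau> \<tau>) z"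
    have "limitin \<tau> fst (fst z) ?F" "limitin \<tau> snd (snd z) ?F"
      using z continuous_map_fst[of \<tau> \<tau>] continuous_map_snd[of \<tau> \<tau>]
      unfolding continuous_map_atin by blast+
    then have z': "fst z \<in> X" "snd z \<in> X" "\<forall>\<^sub>F t in ?F. fst t \<in> X" "\<forall>\<^sub>F t in ?F. snd t \<in> X"
      and lim: "\<And>p. p \<in> P \<Longrightarrow> ((\<lambda>t. p (fst t - fst z) + p (snd t - snd z)) \<longlongrightarrow> 0) ?F"
      by (auto simp: limitin_seminorm_topology_iff intro!: tendsto_add_zero)
    have "((\<lambda>t. p ((fst t + snd t) - (fst z + snd z))) \<longlongrightarrow> 0) ?F" if p: "p \<in> P" for p
    proof (rule Lim_null_comparison[OF _ lim[OF p]])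
      interpret p: seminormed_subspace smul X p by (rule seminormed_subspace_X[OF p])
      show "\<forall>\<^sub>F t in ?F. norm (p (fst t + snd t - (fst z + snd z))) \<le> p (fst t - fst z) + p (snd t - snd z)"
        using z'(3,4)
        by eventually_elim (use z' in \<open>simp add: add_diff_add p.nonneg mem_X p.triangle\<close>)
    qed
    moreover have "\<forall>\<^sub>F t in ?F. fst t + snd t \<in> X"
      using z'(3,4) by eventually_elim (rule mem_X)
    ultimately show "limitin \<tau> (\<lambda>(x, y). x + y) ((\<lambda>(x, y). x + y) z) ?F"
      using z' by (simp add: limitin_seminorm_topology_iff case_prod_unfold mem_X)
  qed
  show "continuous_map (prod_topology euclidean \<tau>) \<tau> (\<lambda>(c, x). smul c x)"
    unfolding continuous_map_atin
  proof
    fix z assume z: "z \<in> topspace (prod_topology (euclidean :: 'k topology) \<tau>)"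
    let ?F = "atin (prod_topology (euclidean :: 'k topology) \<tau>) z"
    have "limitin euclidean fst (fst z) ?F" "limitin \<tau> snd (snd z) ?F"
      using z continuous_map_fst[of euclidean \<tau>] continuous_map_snd[of euclidean \<tau>]
      unfolding continuous_map_atin by blast+
    then have z': "snd z \<in> X" "\<forall>\<^sub>F t in ?F. snd t \<in> X" and c: "(fst \<longlongrightarrow> fst z) ?F"
      and x: "\<And>p. p \<in> P \<Longrightarrow> ((\<lambda>t. p (snd t - snd z)) \<longlongrightarrow> 0) ?F"
      by (auto simp: limitin_seminorm_topology_iff)
    have "((\<lambda>t. p (smul (fst t) (snd t) - smul (fst z) (snd z))) \<longlongrightarrow> 0) ?F" if p: "p \<in> P" for p
    proof (rule Lim_null_comparison)
      interpret p: seminormed_subspace smul X p by (rule seminormed_subspace_X[OF p])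
      have eq: "smul (fst t) (snd t) - smul (fst z) (snd z) =
          smul (fst t) (snd t - snd z) + smul (fst t - fst z) (snd z)" for t
        by (simp add: scale_left_diff_distrib scale_right_diff_distrib)
      show "\<forall>\<^sub>F t in ?F. norm (p (smul (fst t) (snd t) - smul (fst z) (snd z)))
          \<le> norm (fst t) * p (snd t - snd z) + norm (fst t - fst z) * p (snd z)"
        using z'(2)
      proof eventually_elim
        case (elim t)
        then have "p (smul (fst t) (snd t - snd z) + smul (fst t - fst z) (snd z))
          \<le> p (smul (fst t) (snd t - snd z)) + p (smul (fst t - fst z) (snd z))"
          using z' by (intro p.triangle mem_X)
        then show ?case
          unfolding eq using elim z' by (simp add: p.homogeneous p.nonneg mem_X)
      qed
      show "((\<lambda>t. norm (fst t) * p (snd t - snd z) + norm (fst t - fst z) * p (snd z)) \<longlongrightarrow> 0) ?F"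
        by (rule tendsto_eq_intros c x[OF p] refl | simp)+
    qed
    moreover have "\<forall>\<^sub>F t in ?F. smul (fst t) (snd t) \<in> X"
      using z'(2) by eventually_elim (rule mem_X)
    ultimately show "limitin \<tau> (\<lambda>(c, x). smul c x) ((\<lambda>(c, x). smul c x) z) ?F"
      using z' by (simp add: limitin_seminorm_topology_iff case_prod_unfold mem_X)
  qed
  fix N assume "openin \<tau> N" "0 \<in> N"
  then obtain F e where F: "finite F" "F \<subseteq> P" and e: "0 < e"
    and sub: "{\<eta> \<in> X. \<forall>p\<in>F. p (\<eta> - 0) < e} \<subseteq> N"
    using openin_contains_finite_semiball by meson
  let ?C = "{\<eta> \<in> X. \<forall>p\<in>F. p (\<eta> - 0) < e}"
  have "smul (of_real (1 - t)) x + smul (of_real t) y \<in> ?C"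
    if xy: "x \<in> ?C" "y \<in> ?C" and t: "t \<in> {0..1}" for x y t
  proof -
    have "p (smul (of_real (1 - t)) x + smul (of_real t) y) < e" if "p \<in> F" for p
    proof -
      interpret p: seminormed_subspace smul X p
        using F that by (intro seminormed_subspace_X) auto
      have "p (smul (of_real (1 - t)) x + smul (of_real t) y) \<le>
          p (smul (of_real (1 - t)) x) + p (smul (of_real t) y)"
        using xy by (intro p.triangle mem_X) auto
      also have "\<dots> = (1 - t) * p x + t * p y"
        using xy t by (simp add: p.homogeneous del: of_real_diff)
      also have "\<dots> < e"
        using xy t that by (intro convex_bound_lt) auto
      finally show ?thesis .
    qed
    then show ?thesis using xy by (simp add: mem_X)
  qed
  moreover have "p (0 - 0) < e" if "p \<in> F" for p
    using seminormed_subspace.zero[OF seminormed_subspace_X[of p]] F e that by auto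
  then have "0 \<in> ?C" using mem_X(1) by blast
  ultimately show "\<exists>C\<subseteq>N. openin \<tau> C \<and> 0 \<in> C \<and>
      (\<forall>x\<in>C. \<forall>y\<in>C. \<forall>t\<in>{0..1}. smul (of_real (1 - t)) x + smul (of_real t) y \<in> C)"
    using sub openin_finite_semiball[OF F mem_X(1), of e] by (intro exI[of _ ?C]) blast
qed

lemma continuous_seminorm_P:
  assumes p: "p \<in> P" shows "p \<in> continuous_seminorms smul \<tau>"
proof (rule locally_convex_space.continuous_seminormI[OF locally_convex_seminorm_topology])
  interpret p: seminormed_subspace smul X p by (rule seminormed_subspace_X[OF p])
  show "seminorm_on smul (topspace \<tau>) p"
    by (simp add: topspace_seminorm_topology seminorm_on_P p)
  fix e :: real assume "0 < e"
  then show "\<exists>V. openin \<tau> V \<and> 0 \<in> V \<and> (\<forall>x\<in>V. p x \<le> e)"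
    using openin_semiball[OF p mem_X(1), of e]
    by (intro exI[of _ "{\<eta> \<in> X. p (\<eta> - 0) < e}"]) (auto simp: mem_X)
qed

text \<open>The unit ball of a continuous seminorm contains a finite semi-ball, and homogeneity turns this
  inclusion into an inequality. It reduces statements about all continuous seminorms of a
  weighted space to the defining ones.\<close>

lemma continuous_seminorm_bound:
  assumes Q: "Q \<in> continuous_seminorms smul \<tau>"
  obtains F C where "finite F" "F \<subseteq> P" "0 \<le> C" "\<And>x. x \<in> X \<Longrightarrow> Q x \<le> C * (\<Sum>p\<in>F. p x)"
proof -
  interpret Q: seminormed_subspace smul X Q
    using Q continuous_seminormD[OF Q]
    by unfold_locales (auto simp: subspace_X topspace_seminorm_topology)
  have "openin \<tau> {x \<in> topspace \<tau>. Q x \<in> {..<1}}"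
    using Q unfolding continuous_seminorms_iff
    by (intro openin_continuous_map_preimage[of _ euclideanreal]) auto
  moreover have "0 \<in> {x \<in> topspace \<tau>. Q x \<in> {..<1}}"
    by (simp add: topspace_seminorm_topology mem_X)
  ultimately obtain F e where F: "finite F" "F \<subseteq> P" and e: "0 < e"
    and sub: "{\<eta> \<in> X. \<forall>p\<in>F. p (\<eta> - 0) < e} \<subseteq> {x \<in> topspace \<tau>. Q x \<in> {..<1}}"
    using openin_contains_finite_semiball by meson
  have nonneg: "0 \<le> p x" if "p \<in> F" "x \<in> X" for p x
    using that F seminormed_subspace.nonneg[OF seminormed_subspace_X] by blast
  have "Q x \<le> (1 / e) * (\<Sum>p\<in>F. p x)" if x: "x \<in> X" for x
  proof (rule field_le_epsilon)
    fix d :: real assume d: "0 < d"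
    \<comment> \<open>the summand with \<open>d\<close> keeps \<open>s\<close> positive when all seminorms in \<open>F\<close> vanish at \<open>x\<close>\<close>
    define s where "s = (\<Sum>p\<in>F. p x) + d * e"
    have s: "0 < s" using d e nonneg x by (auto simp: s_def intro!: add_nonneg_pos sum_nonneg)
    have "p (smul (of_real (e / s)) x) < e" if p: "p \<in> F" for p
    proof -
      interpret p: seminormed_subspace smul X p using F p by (intro seminormed_subspace_X) auto
      have "p x \<le> (\<Sum>p\<in>F. p x)" using F p x nonneg by (intro member_le_sum) auto
      also have "\<dots> < s" using d e by (simp add: s_def)
      finally have "p x < s" .
      then show ?thesis
        using e s x by (simp add: p.homogeneous field_simps norm_divide del: of_real_divide flip: of_real_divide)
    qed
    then have "smul (of_real (e / s)) x \<in> {\<eta> \<in> X. \<forall>p\<in>F. p (\<eta> - 0) < e}"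
      using x by (simp add: mem_X)
    then have "Q (smul (of_real (e / s)) x) < 1" using sub by blast
    moreover have "Q (smul (of_real (e / s)) x) = e / s * Q x"
      using e s x by (simp add: Q.homogeneous del: of_real_divide)
    ultimately have "e * Q x / s < 1" by simp
    then have "Q x < s / e" using e s by (simp add: pos_divide_less_eq pos_less_divide_eq mult.commute)
    then show "Q x \<le> 1 / e * (\<Sum>p\<in>F. p x) + d"
      using e by (simp add: s_def field_simps)
  qed
  with F e show ?thesis by (intro that[of F "1 / e"]) auto
qed

lemma Hausdorff_seminorm_topology:
  assumes sep: "\<And>x. x \<in> X \<Longrightarrow> \<forall>p\<in>P. p x = 0 \<Longrightarrow> x = 0"
  shows "Hausdorff_space \<tau>"
  unfolding Hausdorff_space_def topspace_seminorm_topology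
proof (intro allI impI)
  fix x y assume xy: "x \<in> X \<and> y \<in> X \<and> x \<noteq> y"
  then obtain p where p: "p \<in> P" "p (x - y) \<noteq> 0"
    using sep[of "x - y"] by (auto simp: mem_X)
  interpret p: seminormed_subspace smul X p by (rule seminormed_subspace_X[OF p(1)])
  define r where "r = p (x - y) / 2"
  have r: "0 < r" using p(2) p.nonneg[of "x - y"] xy by (simp add: r_def mem_X less_le)
  let ?A = "{\<eta> \<in> X. p (\<eta> - x) < r}" and ?B = "{\<eta> \<in> X. p (\<eta> - y) < r}"
  have "disjnt ?A ?B"
  proof -
    have False if "z \<in> X" "p (z - x) < r" "p (z - y) < r" for z
      using p.triangle_via[of x z y] p.minus_commute[of x z] that xy by (simp add: r_def)
    then show ?thesis by (auto simp: disjnt_def)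
  qed
  then show "\<exists>U V. openin \<tau> U \<and> openin \<tau> V \<and> x \<in> U \<and> y \<in> V \<and> disjnt U V"
    using openin_semiball[OF p(1)] xy r by (intro exI[of _ ?A] exI[of _ ?B]) auto
qed

end

text \<open>The index set with its map \<open>pr\<close> allows the same seminorm to be used several times in
  the bounding sum.\<close>

lemma continuous_map_seminorm_topologies:
  assumes "seminorm_family smul X P" "seminorm_family smul' Y R"
    and L: "\<And>x. x \<in> X \<Longrightarrow> L x \<in> Y" "\<And>x y. x \<in> X \<Longrightarrow> y \<in> X \<Longrightarrow> L (x - y) = L x - L y"
    and bound: "\<And>r. r \<in> R \<Longrightarrow> \<exists>(F :: 'j set) pr C. finite F \<and> pr ` F \<subseteq> P \<and>
      (\<forall>x\<in>X. r (L x) \<le> C * (\<Sum>j\<in>F. pr j x))"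
  shows "continuous_map (seminorm_topology X P) (seminorm_topology Y R) L"
proof -
  interpret X: seminorm_family smul X P by fact
  interpret Y: seminorm_family smul' Y R by fact
  show ?thesis
    unfolding continuous_map_atin
  proof
    fix x assume "x \<in> topspace X.\<tau>"
    then have x: "x \<in> X" by (simp add: X.topspace_seminorm_topology)
    have "limitin X.\<tau> (\<lambda>a. a) x (atin X.\<tau> x)"
      using x continuous_map_id[of X.\<tau>] unfolding continuous_map_atin
      by (auto simp: X.topspace_seminorm_topology id_def)
    then have ev: "\<forall>\<^sub>F a in atin X.\<tau> x. a \<in> X"
      and lim: "\<And>p. p \<in> P \<Longrightarrow> ((\<lambda>a. p (a - x)) \<longlongrightarrow> 0) (atin X.\<tau> x)"
      by (auto simp: X.limitin_seminorm_topology_iff)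
    have "((\<lambda>a. r (L a - L x)) \<longlongrightarrow> 0) (atin X.\<tau> x)" if r: "r \<in> R" for r
    proof -
      obtain F :: "'j set" and pr C where F: "finite F" "pr ` F \<subseteq> P"
        and le: "\<And>x. x \<in> X \<Longrightarrow> r (L x) \<le> C * (\<Sum>j\<in>F. pr j x)"
        using bound[OF r] by blast
      show ?thesis
      proof (rule Lim_null_comparison)
        show "\<forall>\<^sub>F a in atin X.\<tau> x. norm (r (L a - L x)) \<le> C * (\<Sum>j\<in>F. pr j (a - x))"
          using ev
        proof eventually_elim
          case (elim a)
          have "0 \<le> r (L a - L x)"
            using seminormed_subspace.nonneg[OF Y.seminormed_subspace_X[OF r]] elim x L Y.mem_X by simp
          with le[of "a - x"] elim x show ?case by (simp add: L X.mem_X)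
        qed
        have "((\<lambda>a. \<Sum>j\<in>F. pr j (a - x)) \<longlongrightarrow> 0) (atin X.\<tau> x)"
          using F by (intro tendsto_null_sum lim) auto
        then show "((\<lambda>a. C * (\<Sum>j\<in>F. pr j (a - x))) \<longlongrightarrow> 0) (atin X.\<tau> x)"
          by (rule tendsto_mult_right_zero)
      qed
    qed
    moreover have "\<forall>\<^sub>F a in atin X.\<tau> x. L a \<in> Y"
      using ev by eventually_elim (rule L)
    ultimately show "limitin Y.\<tau> L (L x) (atin X.\<tau> x)"
      using x L by (simp add: Y.limitin_seminorm_topology_iff)
  qed
qed

section \<open>Iterated partial derivatives\<close>

locale hausdorff_locally_convex_space = locally_convex_space smul T
  for smul :: "'k::real_normed_field \<Rightarrow> 'e::ab_group_add \<Rightarrow> 'e" and T +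
  assumes Hausdorff: "Hausdorff_space T"

lemma eventually_shift_in_open:
  fixes x :: "'a::real_normed_vector"
  assumes "open V" "x \<in> V"
  shows "\<forall>\<^sub>F t in at (0::real). x + t *\<^sub>R v \<in> V"
proof (rule topological_tendstoD[OF _ assms])
  show "((\<lambda>t. x + t *\<^sub>R v) \<longlongrightarrow> x) (at 0)"
    by (rule tendsto_eq_intros refl | simp)+
qed

context locally_convex_space
begin

lemma has_partial_deriv_cong:
  assumes "open V" "\<And>x. x \<in> V \<Longrightarrow> f x = f' x" "\<And>x. x \<in> V \<Longrightarrow> g x = g' x"
    and "has_partial_deriv smul T V i f g"
  shows "has_partial_deriv smul T V i f' g'"
  unfolding has_partial_deriv_def
proof
  fix x assume x: "x \<in> V"
  have "limitin T (\<lambda>t. smul (of_real (1 / t)) (f (x + t *\<^sub>R axis i 1) - f x)) (g x) (at 0)"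
    using assms(4) x by (simp add: has_partial_deriv_def)
  moreover have "\<forall>\<^sub>F t in at 0. smul (of_real (1 / t)) (f (x + t *\<^sub>R axis i 1) - f x) =
      smul (of_real (1 / t)) (f' (x + t *\<^sub>R axis i 1) - f' x)"
    using eventually_shift_in_open[OF assms(1) x, of "axis i 1"]
    by eventually_elim (use x assms(2) in simp)
  ultimately show "limitin T (\<lambda>t. smul (of_real (1 / t)) (f' (x + t *\<^sub>R axis i 1) - f' x)) (g' x) (at 0)"
    unfolding assms(3)[OF x, symmetric] by (rule limitin_transform_eventually[rotated])
qed

lemma has_iterated_deriv_cong:
  assumes "open V" "\<And>x. x \<in> V \<Longrightarrow> f x = f' x" "\<And>x. x \<in> V \<Longrightarrow> g x = g' x"
    and "has_iterated_deriv smul T V is f g"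
  shows "has_iterated_deriv smul T V is f' g'"
  using assms(3,4)
proof (induction "is" arbitrary: g g')
  case Nil
  then show ?case using assms(2) by simp
next
  case (Cons i "is")
  then obtain h where h: "has_iterated_deriv smul T V is f h" "has_partial_deriv smul T V i h g"
    by auto
  have "has_iterated_deriv smul T V is f' h"
    by (rule Cons.IH[OF _ h(1)]) simp
  moreover have "has_partial_deriv smul T V i h g'"
    by (rule has_partial_deriv_cong[OF \<open>open V\<close> _ _ h(2)]) (simp_all add: Cons.prems)
  ultimately show ?case by auto
qed

lemma has_iterated_deriv_in_topspace:
  assumes "has_iterated_deriv smul T V is f g" "\<And>x. x \<in> V \<Longrightarrow> f x \<in> topspace T" "x \<in> V"
  shows "g x \<in> topspace T"
proof (cases "is")
  case (Cons i js)
  then show ?thesis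
    using assms(1,3) by (auto simp: has_partial_deriv_def intro: limitin_topspace)
qed (use assms in simp)

lemma has_partial_deriv_add:
  assumes "has_partial_deriv smul T V i f g" "has_partial_deriv smul T V i f' g'"
  shows "has_partial_deriv smul T V i (\<lambda>x. f x + f' x) (\<lambda>x. g x + g' x)"
  unfolding has_partial_deriv_def
proof
  fix x assume "x \<in> V"
  then have "limitin T (\<lambda>t. smul (of_real (1 / t)) (f (x + t *\<^sub>R axis i 1) - f x)
      + smul (of_real (1 / t)) (f' (x + t *\<^sub>R axis i 1) - f' x)) (g x + g' x) (at 0)"
    using assms by (intro limitin_add) (simp_all add: has_partial_deriv_def)
  then show "limitin T (\<lambda>t. smul (of_real (1 / t))
      (f (x + t *\<^sub>R axis i 1) + f' (x + t *\<^sub>R axis i 1) - (f x + f' x))) (g x + g' x) (at 0)"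
    by (simp add: add_diff_add scale_right_distrib)
qed

lemma has_iterated_deriv_add:
  assumes "has_iterated_deriv smul T V is f g" "has_iterated_deriv smul T V is f' g'"
  shows "has_iterated_deriv smul T V is (\<lambda>x. f x + f' x) (\<lambda>x. g x + g' x)"
  using assms
proof (induction "is" arbitrary: g g')
  case (Cons i "is")
  from Cons.prems obtain h h' where
    "has_iterated_deriv smul T V is f h" "has_partial_deriv smul T V i h g"
    "has_iterated_deriv smul T V is f' h'" "has_partial_deriv smul T V i h' g'" by auto
  then show ?case using Cons.IH[of h h'] has_partial_deriv_add[of V i h g h' g'] by auto
qed simp

text \<open>Differentiation commutes with continuous linear maps. In the exponential law the linear map
  is the evaluation, at a fixed point, of a derivative in the second variable; derivatives in the
  first variable therefore pass through it.\<close>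

lemma has_iterated_deriv_linear_image:
  assumes smul': "vector_space smul'" and cont: "continuous_map T T' L"
    and add: "\<And>x y. x \<in> topspace T \<Longrightarrow> y \<in> topspace T \<Longrightarrow> L (x + y) = L x + L y"
    and scale: "\<And>c x. x \<in> topspace T \<Longrightarrow> L (smul c x) = smul' c (L x)"
    and V: "open V" and f: "\<And>x. x \<in> V \<Longrightarrow> f x \<in> topspace T"
    and "has_iterated_deriv smul T V is f g"
  shows "has_iterated_deriv smul' T' V is (\<lambda>x. L (f x)) (\<lambda>x. L (g x))"
  using assms(7)
proof (induction "is" arbitrary: g)
  case (Cons i "is")
  interpret smul': vector_space smul' by fact
  from Cons.prems obtain h where h: "has_iterated_deriv smul T V is f h"
    and part: "has_partial_deriv smul T V i h g" by auto
  note h_in = has_iterated_deriv_in_topspace[OF h f]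
  have diff: "L (x - y) = L x - L y" if "x \<in> topspace T" "y \<in> topspace T" for x y
    using add[of "x - y" y] that topspace_diff by simp
  have "has_partial_deriv smul' T' V i (\<lambda>x. L (h x)) (\<lambda>x. L (g x))"
    unfolding has_partial_deriv_def
  proof
    fix x assume x: "x \<in> V"
    have "limitin T' (L \<circ> (\<lambda>t. smul (of_real (1 / t)) (h (x + t *\<^sub>R axis i 1) - h x))) (L (g x)) (at 0)"
      using part x by (intro continuous_map_limit[OF cont]) (simp add: has_partial_deriv_def)
    moreover have "\<forall>\<^sub>F t in at 0. (L \<circ> (\<lambda>t. smul (of_real (1 / t)) (h (x + t *\<^sub>R axis i 1) - h x))) t =
        smul' (of_real (1 / t)) (L (h (x + t *\<^sub>R axis i 1)) - L (h x))"
      using eventually_shift_in_open[OF V x, of "axis i 1"]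
      by eventually_elim (use h_in x in \<open>simp add: scale diff topspace_diff\<close>)
    ultimately show "limitin T' (\<lambda>t. smul' (of_real (1 / t)) (L (h (x + t *\<^sub>R axis i 1)) - L (h x)))
        (L (g x)) (at 0)"
      by (rule limitin_transform_eventually[rotated])
  qed
  with Cons.IH[OF h] show ?case by auto
qed simp

lemma is_multi_deriv_linear_image:
  assumes "vector_space smul'" "continuous_map T T' L"
    and "\<And>x y. x \<in> topspace T \<Longrightarrow> y \<in> topspace T \<Longrightarrow> L (x + y) = L x + L y"
    and "\<And>c x. x \<in> topspace T \<Longrightarrow> L (smul c x) = smul' c (L x)"
    and "\<And>x. x \<in> S \<Longrightarrow> f x \<in> topspace T" and "is_multi_deriv smul T S \<alpha> f g"
  shows "is_multi_deriv smul' T' S \<alpha> (\<lambda>x. L (f x)) (\<lambda>x. L (g x))"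
  unfolding is_multi_deriv_def
proof
  have "\<And>x. x \<in> interior S \<Longrightarrow> f x \<in> topspace T" using assms(5) interior_subset by blast
  then show "has_iterated_deriv smul' T' (interior S) (index_list \<alpha>) (\<lambda>x. L (f x)) (\<lambda>x. L (g x))"
    using assms(6) unfolding is_multi_deriv_def
    by (intro has_iterated_deriv_linear_image[OF assms(1-4)]) auto
  show "continuous_map (top_of_set S) T' (\<lambda>x. L (g x))"
    using continuous_map_compose[OF _ assms(2)] assms(6) by (auto simp: is_multi_deriv_def o_def)
qed

end

context hausdorff_locally_convex_space
begin

lemma seminorms_separate:
  assumes x: "x \<in> topspace T" and zero: "\<And>q. q \<in> continuous_seminorms smul T \<Longrightarrow> q x = 0"
  shows "x = 0"
proof (rule ccontr)
  assume "x \<noteq> 0"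
  then obtain N where N: "openin T N" "0 \<in> N" "x \<notin> N"
    using Hausdorff x topspace_0 unfolding Hausdorff_space_def disjnt_iff by metis
  obtain q where q: "q \<in> continuous_seminorms smul T" "\<And>y. y \<in> topspace T \<Longrightarrow> q y < 1 \<Longrightarrow> y \<in> N"
    using neighbourhood_contains_seminorm_ball[OF N(1,2)] by blast
  show False using q(2)[OF x] zero[OF q(1)] N(3) by simp
qed

lemma has_iterated_deriv_unique:
  assumes "open V" "has_iterated_deriv smul T V is f g" "has_iterated_deriv smul T V is f g'" "x \<in> V"
  shows "g x = g' x"
  using assms(2-4)
proof (induction "is" arbitrary: g g' x)
  case (Cons i "is")
  from Cons.prems obtain h h' where h: "has_iterated_deriv smul T V is f h" "has_partial_deriv smul T V i h g"
    and h': "has_iterated_deriv smul T V is f h'" "has_partial_deriv smul T V i h' g'" by auto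
  have "has_partial_deriv smul T V i h g'"
    by (rule has_partial_deriv_cong[OF assms(1) _ _ h'(2)]) (simp_all add: Cons.IH[OF h'(1) h(1)])
  with h(2) Cons.prems(3) show ?case
    unfolding has_partial_deriv_def
    using limitin_Hausdorff_unique[OF _ _ _ Hausdorff] trivial_limit_at by blast
qed simp

context
  fixes S :: "(real, 'n::{finite,linorder}) vec set"
  assumes dense: "S \<subseteq> closure (interior S)"
begin

text \<open>Two extensions of the same iterated derivative agree on the dense interior by uniqueness of
  limits, hence everywhere. This makes the definite description in \<^const>\<open>multi_deriv\<close>
  meaningful.\<close>

lemma is_multi_deriv_unique:
  assumes g: "is_multi_deriv smul T S \<alpha> f g" and g': "is_multi_deriv smul T S \<alpha> f g'" and x: "x \<in> S"
  shows "g x = g' x"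
proof (rule forall_in_closure_of_eq[where X = "top_of_set S" and Y = T and S = "interior S"])
  show "x \<in> top_of_set S closure_of interior S"
    using x dense interior_subset[of S] by (auto simp: closure_of_subtopology Int_absorb1)
  show "\<And>y. y \<in> interior S \<Longrightarrow> g y = g' y"
    using g g' has_iterated_deriv_unique[OF open_interior] by (auto simp: is_multi_deriv_def)
qed (use g g' Hausdorff in \<open>auto simp: is_multi_deriv_def\<close>)

lemma is_multi_deriv_cong:
  assumes "is_multi_deriv smul T S \<alpha> f g"
    and f: "\<And>x. x \<in> S \<Longrightarrow> f x = f' x" and g: "\<And>x. x \<in> S \<Longrightarrow> g x = g' x"
  shows "is_multi_deriv smul T S \<alpha> f' g'"
  unfolding is_multi_deriv_def
proof
  show "has_iterated_deriv smul T (interior S) (index_list \<alpha>) f' g'"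
    using assms interior_subset[of S]
    by (intro has_iterated_deriv_cong[OF open_interior, of S f f' g g']) (auto simp: is_multi_deriv_def)
  show "continuous_map (top_of_set S) T g'"
    by (rule continuous_map_eq[of _ _ g]) (use assms in \<open>auto simp: is_multi_deriv_def\<close>)
qed

lemma multi_deriv_eq:
  assumes g: "is_multi_deriv smul T S \<alpha> f g"
  shows "multi_deriv smul T S \<alpha> f = (\<lambda>x. if x \<in> S then g x else 0)"
  unfolding multi_deriv_def
proof (rule the_equality)
  show "is_multi_deriv smul T S \<alpha> f (\<lambda>x. if x \<in> S then g x else 0) \<and>
      (\<forall>x. x \<notin> S \<longrightarrow> (if x \<in> S then g x else 0) = 0)"
    using is_multi_deriv_cong[OF g] by auto
  fix h assume h: "is_multi_deriv smul T S \<alpha> f h \<and> (\<forall>x. x \<notin> S \<longrightarrow> h x = 0)"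
  then show "h = (\<lambda>x. if x \<in> S then g x else 0)"
    using is_multi_deriv_unique[OF _ g] by auto
qed

lemma Ck_on_multi_deriv:
  assumes "Ck_on smul T k S f" "mi_order \<alpha> \<le> k"
  shows "is_multi_deriv smul T S \<alpha> f (multi_deriv smul T S \<alpha> f)"
proof -
  obtain g where g: "is_multi_deriv smul T S \<alpha> f g"
    using assms by (auto simp: Ck_on_def)
  then show ?thesis
    unfolding multi_deriv_eq[OF g] by (rule is_multi_deriv_cong) auto
qed

lemma multi_deriv_outside:
  assumes "Ck_on smul T k S f" "mi_order \<alpha> \<le> k" "x \<notin> S"
  shows "multi_deriv smul T S \<alpha> f x = 0"
  using multi_deriv_eq[OF Ck_on_multi_deriv[OF assms(1,2)]] assms(3) by metis

lemma Ck_on_in_topspace: "Ck_on smul T k S f \<Longrightarrow> x \<in> S \<Longrightarrow> f x \<in> topspace T"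
  by (auto simp: Ck_on_def continuous_map_top_of_set_iff)

lemma multi_deriv_in_topspace:
  assumes "Ck_on smul T k S f" "mi_order \<alpha> \<le> k" "x \<in> S"
  shows "multi_deriv smul T S \<alpha> f x \<in> topspace T"
  using Ck_on_multi_deriv[OF assms(1,2)] assms(3)
  by (auto simp: is_multi_deriv_def continuous_map_top_of_set_iff)

lemma Ck_on_add:
  assumes f: "Ck_on smul T k S f" and g: "Ck_on smul T k S g"
  shows "Ck_on smul T k S (f + g)"
    and "mi_order \<alpha> \<le> k \<Longrightarrow>
      multi_deriv smul T S \<alpha> (f + g) = multi_deriv smul T S \<alpha> f + multi_deriv smul T S \<alpha> g"
proof -
  have *: "is_multi_deriv smul T S \<alpha> (f + g) (multi_deriv smul T S \<alpha> f + multi_deriv smul T S \<alpha> g)"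
    if "mi_order \<alpha> \<le> k" for \<alpha>
    using Ck_on_multi_deriv[OF f that] Ck_on_multi_deriv[OF g that]
    unfolding is_multi_deriv_def plus_fun_def
    by (intro conjI has_iterated_deriv_add continuous_map_add) auto
  then show "Ck_on smul T k S (f + g)"
    using f g unfolding Ck_on_def plus_fun_def by (auto intro!: continuous_map_add)
  assume \<alpha>: "mi_order \<alpha> \<le> k"
  show "multi_deriv smul T S \<alpha> (f + g) = multi_deriv smul T S \<alpha> f + multi_deriv smul T S \<alpha> g"
    using multi_deriv_outside[OF f \<alpha>] multi_deriv_outside[OF g \<alpha>]
    by (auto simp: multi_deriv_eq[OF *[OF \<alpha>]] fun_eq_iff)
qed

lemma Ck_on_scale:
  assumes f: "Ck_on smul T k S f"
  shows "Ck_on smul T k S (fun_scale smul c f)"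
    and "mi_order \<alpha> \<le> k \<Longrightarrow>
      multi_deriv smul T S \<alpha> (fun_scale smul c f) = fun_scale smul c (multi_deriv smul T S \<alpha> f)"
proof -
  have *: "is_multi_deriv smul T S \<alpha> (fun_scale smul c f) (fun_scale smul c (multi_deriv smul T S \<alpha> f))"
    if "mi_order \<alpha> \<le> k" for \<alpha>
    unfolding fun_scale_def
    by (rule is_multi_deriv_linear_image[OF vector_space_axioms continuous_map_scale_const _ _ _
          Ck_on_multi_deriv[OF f that]])
      (auto simp: scale_right_distrib mult.commute Ck_on_in_topspace[OF f])
  then show "Ck_on smul T k S (fun_scale smul c f)"
    using f continuous_map_compose[OF _ continuous_map_scale_const, of "top_of_set S" f c]
    unfolding Ck_on_def by (auto simp: fun_scale_def o_def)
  assume \<alpha>: "mi_order \<alpha> \<le> k"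
  show "multi_deriv smul T S \<alpha> (fun_scale smul c f) = fun_scale smul c (multi_deriv smul T S \<alpha> f)"
    unfolding multi_deriv_eq[OF *[OF \<alpha>]]
    using multi_deriv_outside[OF f \<alpha>] by (auto simp: fun_eq_iff fun_scale_def)
qed

end

end

lemma index_list_zero: "index_list (\<lambda>_. 0) = []"
  by (simp add: index_list_def)

lemma mi_order_zero: "mi_order (\<lambda>_. 0) = 0"
  by (simp add: mi_order_def zero_enat_def)

lemma concat_replicate_Cons:
  assumes "distinct xs" "concat (map (\<lambda>i. replicate (\<alpha> i) i) xs) \<noteq> []"
  shows "\<exists>i\<in>set xs. \<alpha> i \<noteq> 0 \<and> concat (map (\<lambda>i. replicate (\<alpha> i) i) xs) =
    i # concat (map (\<lambda>j. replicate ((\<alpha>(i := \<alpha> i - 1)) j) j) xs)"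
  using assms
proof (induction xs)
  case (Cons x xs)
  show ?case
  proof (cases "\<alpha> x = 0")
    case True
    with Cons obtain i where "i \<in> set xs" "\<alpha> i \<noteq> 0" "concat (map (\<lambda>i. replicate (\<alpha> i) i) xs) =
      i # concat (map (\<lambda>j. replicate ((\<alpha>(i := \<alpha> i - 1)) j) j) xs)" by auto
    with Cons.prems(1) True show ?thesis by (intro bexI[of _ i]) auto
  next
    case False
    then obtain n where n: "\<alpha> x = Suc n" by (cases "\<alpha> x") auto
    have "map (\<lambda>j. replicate ((\<alpha>(x := n)) j) j) xs = map (\<lambda>j. replicate (\<alpha> j) j) xs"
      using Cons.prems(1) by (intro map_cong) auto
    then have "concat (map (\<lambda>j. replicate ((\<alpha>(x := n)) j) j) xs) =
        concat (map (\<lambda>j. replicate (\<alpha> j) j) xs)" by (rule arg_cong)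
    with n show ?thesis by (intro bexI[of _ x]) (auto simp del: fun_upd_apply simp: fun_upd_same)
  qed
qed simp

text \<open>Multi-indices are peeled off from the outermost derivative: removing the head of the index
  list of a multi-index leaves the index list of a smaller multi-index, so that maps of class
  C^k carry all intermediate derivatives.\<close>

lemma multi_index_cases:
  fixes \<alpha> :: "'n::{finite,linorder} \<Rightarrow> nat"
  obtains "\<alpha> = (\<lambda>_. 0)"
  | i \<alpha>' where "index_list \<alpha> = i # index_list \<alpha>'" "sum \<alpha> UNIV = Suc (sum \<alpha>' UNIV)"
proof (cases "index_list \<alpha> = []")
  case True
  then have "\<alpha> = (\<lambda>_. 0)" by (auto simp: index_list_def)
  then show ?thesis by (rule that(1))
next
  case False
  then obtain i where i: "\<alpha> i \<noteq> 0" and eq: "index_list \<alpha> = i # index_list (\<alpha>(i := \<alpha> i - 1))"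
    using concat_replicate_Cons[of "sorted_list_of_set UNIV" \<alpha>] by (auto simp: index_list_def)
  have "sum \<alpha> UNIV = \<alpha> i + sum \<alpha> (UNIV - {i})" by (simp add: sum.remove)
  moreover have "sum (\<alpha>(i := \<alpha> i - 1)) UNIV = \<alpha> i - 1 + sum \<alpha> (UNIV - {i})"
    by (subst sum.remove[of UNIV i]) (auto intro!: sum.cong)
  ultimately show ?thesis using that(2)[OF eq] i by simp
qed

text \<open>Conversely to the peeling, iterated derivatives are built up one index at a time. Only
  multi-indices occur as stages, never arbitrary index lists, so the stages can be a family of
  maps indexed by multi-indices.\<close>

lemma has_iterated_deriv_family:
  assumes start: "\<And>x. x \<in> V \<Longrightarrow> G (\<lambda>_. 0) x = f x"
    and step: "\<And>i \<alpha> \<alpha>'. index_list \<alpha> = i # index_list \<alpha>' \<Longrightarrow> mi_order \<alpha> \<le> l \<Longrightarrow> mi_order \<alpha>' \<le> l \<Longrightarrow>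
      has_partial_deriv smul T V i (G \<alpha>') (G \<alpha>)"
    and "mi_order \<alpha> \<le> l"
  shows "has_iterated_deriv smul T V (index_list \<alpha>) f (G \<alpha>)"
  using assms(3)
proof (induction "sum \<alpha> UNIV" arbitrary: \<alpha>)
  case 0
  then have "\<alpha> = (\<lambda>_. 0)" by (auto simp: fun_eq_iff)
  then show ?case by (simp add: index_list_zero start)
next
  case (Suc n)
  show ?case
  proof (cases \<alpha> rule: multi_index_cases)
    case 1
    with Suc.hyps(2) show ?thesis by simp
  next
    case (2 i \<alpha>')
    have le: "mi_order \<alpha>' \<le> l"
      using 2(2) Suc.prems order_trans[of "mi_order \<alpha>'" "mi_order \<alpha>" l] by (simp add: mi_order_def)
    then have "has_iterated_deriv smul T V (index_list \<alpha>') f (G \<alpha>')"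
      using 2(2) Suc.hyps by simp
    moreover have "has_partial_deriv smul T V i (G \<alpha>') (G \<alpha>)"
      using step[OF 2(1) Suc.prems le] .
    ultimately show ?thesis unfolding 2(1) by auto
  qed
qed

context hausdorff_locally_convex_space
begin

lemma has_partial_deriv_multi_deriv:
  assumes dense: "S \<subseteq> closure (interior S)" and f: "Ck_on smul T k S f"
    and \<alpha>: "index_list \<alpha> = i # index_list \<alpha>'" "mi_order \<alpha> \<le> k" "mi_order \<alpha>' \<le> k"
  shows "has_partial_deriv smul T (interior S) i (multi_deriv smul T S \<alpha>' f) (multi_deriv smul T S \<alpha> f)"
proof -
  obtain h where h: "has_iterated_deriv smul T (interior S) (index_list \<alpha>') f h"
    and part: "has_partial_deriv smul T (interior S) i h (multi_deriv smul T S \<alpha> f)"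
    using Ck_on_multi_deriv[OF dense f \<alpha>(2)] \<alpha>(1) by (auto simp: is_multi_deriv_def)
  have "has_iterated_deriv smul T (interior S) (index_list \<alpha>') f (multi_deriv smul T S \<alpha>' f)"
    using Ck_on_multi_deriv[OF dense f \<alpha>(3)] by (simp add: is_multi_deriv_def)
  then show ?thesis
    using has_iterated_deriv_unique[OF open_interior h]
    by (intro has_partial_deriv_cong[OF open_interior _ _ part]) auto
qed

end

section \<open>Weighted spaces as locally convex spaces\<close>

lemma vector_space_fun_scale:
  assumes "vector_space smul" shows "vector_space (fun_scale smul)"
proof -
  interpret vector_space smul by fact
  show ?thesis
    by unfold_locales
      (simp_all add: fun_scale_def fun_eq_iff scale_right_distrib scale_left_distrib)
qed

lemma SUP_ennreal_le_iff:
  assumes "0 \<le> c"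
  shows "(SUP x\<in>S. ennreal (F x)) \<le> ennreal c \<longleftrightarrow> (\<forall>x\<in>S. F x \<le> c)"
  using assms by (simp add: SUP_le_iff ennreal_le_iff)

lemma SUP_ennreal_finite_iff: "(SUP x\<in>S. ennreal (F x)) < \<infinity> \<longleftrightarrow> (\<exists>c\<ge>0. \<forall>x\<in>S. F x \<le> c)"
proof
  assume "(SUP x\<in>S. ennreal (F x)) < \<infinity>"
  then obtain c where "0 \<le> c" "(SUP x\<in>S. ennreal (F x)) = ennreal c"
    by (cases "SUP x\<in>S. ennreal (F x)") auto
  then show "\<exists>c\<ge>0. \<forall>x\<in>S. F x \<le> c"
    using SUP_ennreal_le_iff[of c F S] by auto
next
  assume "\<exists>c\<ge>0. \<forall>x\<in>S. F x \<le> c"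
  then obtain c where "(SUP x\<in>S. ennreal (F x)) \<le> ennreal c"
    using SUP_ennreal_le_iff[of _ F S] by blast
  then show "(SUP x\<in>S. ennreal (F x)) < \<infinity>" using le_less_trans by fastforce
qed

locale weighted_Ck_space = hausdorff_locally_convex_space smul T
  for smul :: "'k::real_normed_field \<Rightarrow> 'e::ab_group_add \<Rightarrow> 'e" and T +
  fixes S :: "(real, 'n::{finite,linorder}) vec set" and k :: enat
    and W :: "((real, 'n) vec \<Rightarrow> real) set"
  assumes dense: "S \<subseteq> closure (interior S)" and weights: "set_of_weights S W"
begin

abbreviation X :: "((real, 'n) vec \<Rightarrow> 'e) set" where
  "X \<equiv> weighted_Ck smul T k S W"

abbreviation D :: "('n \<Rightarrow> nat) \<Rightarrow> ((real, 'n) vec \<Rightarrow> 'e) \<Rightarrow> (real, 'n) vec \<Rightarrow> 'e" where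
  "D \<equiv> multi_deriv smul T S"

text \<open>The weighted seminorm is finite on the weighted space, and as a real function it can be a
  continuous seminorm of that space.\<close>

definition wnorm :: "((real, 'n) vec \<Rightarrow> real) \<Rightarrow> ('n \<Rightarrow> nat) \<Rightarrow> ('e \<Rightarrow> real) \<Rightarrow>
    ((real, 'n) vec \<Rightarrow> 'e) \<Rightarrow> real" where
  "wnorm f \<alpha> q \<gamma> = enn2real (weighted_seminorm smul T S f \<alpha> q \<gamma>)"

definition wnorms :: "(((real, 'n) vec \<Rightarrow> 'e) \<Rightarrow> real) set" where
  "wnorms = {wnorm f \<alpha> q | f \<alpha> q. f \<in> W \<and> mi_order \<alpha> \<le> k \<and> q \<in> continuous_seminorms smul T}"

lemma weight_nonneg: "f \<in> W \<Longrightarrow> x \<in> S \<Longrightarrow> 0 \<le> f x"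
  using weights by (auto simp: set_of_weights_def)

lemma ex_positive_weight: "x \<in> S \<Longrightarrow> \<exists>f\<in>W. 0 < f x"
  using weights by (simp add: set_of_weights_def)

lemma mem_weighted_Ck_iff:
  "\<gamma> \<in> X \<longleftrightarrow> Ck_on smul T k S \<gamma> \<and> (\<forall>x. x \<notin> S \<longrightarrow> \<gamma> x = 0) \<and>
     (\<forall>f\<in>W. \<forall>q\<in>continuous_seminorms smul T. \<forall>\<alpha>. mi_order \<alpha> \<le> k \<longrightarrow>
        (\<exists>c\<ge>0. \<forall>x\<in>S. f x * q (D \<alpha> \<gamma> x) \<le> c))"
  unfolding weighted_Ck_def weighted_seminorm_def SUP_ennreal_finite_iff by simp

lemma Ck_on_weighted_Ck: "\<gamma> \<in> X \<Longrightarrow> Ck_on smul T k S \<gamma>"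
  by (simp add: weighted_Ck_def)

lemma weighted_Ck_outside: "\<gamma> \<in> X \<Longrightarrow> x \<notin> S \<Longrightarrow> \<gamma> x = 0"
  by (simp add: weighted_Ck_def)

lemma D_in_topspace: "\<gamma> \<in> X \<Longrightarrow> mi_order \<alpha> \<le> k \<Longrightarrow> x \<in> S \<Longrightarrow> D \<alpha> \<gamma> x \<in> topspace T"
  using multi_deriv_in_topspace[OF dense Ck_on_weighted_Ck] .

lemma D_zero_index:
  assumes "\<gamma> \<in> X" shows "D (\<lambda>_. 0) \<gamma> = \<gamma>"
proof -
  have "is_multi_deriv smul T S (\<lambda>_. 0) \<gamma> \<gamma>"
    using Ck_on_weighted_Ck[OF assms] by (simp add: is_multi_deriv_def index_list_zero Ck_on_def)
  from multi_deriv_eq[OF dense this] show ?thesis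
    using weighted_Ck_outside[OF assms] by auto
qed

lemma D_add:
  "\<gamma> \<in> X \<Longrightarrow> \<eta> \<in> X \<Longrightarrow> mi_order \<alpha> \<le> k \<Longrightarrow> D \<alpha> (\<gamma> + \<eta>) = D \<alpha> \<gamma> + D \<alpha> \<eta>"
  by (rule Ck_on_add(2)[OF dense Ck_on_weighted_Ck Ck_on_weighted_Ck])

lemma D_scale: "\<gamma> \<in> X \<Longrightarrow> mi_order \<alpha> \<le> k \<Longrightarrow> D \<alpha> (fun_scale smul c \<gamma>) = fun_scale smul c (D \<alpha> \<gamma>)"
  by (rule Ck_on_scale(2)[OF dense Ck_on_weighted_Ck])

lemma D_scale_apply:
  "\<gamma> \<in> X \<Longrightarrow> mi_order \<alpha> \<le> k \<Longrightarrow> D \<alpha> (fun_scale smul c \<gamma>) x = smul c (D \<alpha> \<gamma> x)"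
  by (simp only: D_scale) (simp add: fun_scale_def)

sublocale fun_scale: vector_space "fun_scale smul"
  by (rule vector_space_fun_scale[OF vector_space_axioms])

lemma wnorm_bounds:
  assumes "\<gamma> \<in> X" "f \<in> W" "mi_order \<alpha> \<le> k" "q \<in> continuous_seminorms smul T"
  shows ennreal_wnorm: "ennreal (wnorm f \<alpha> q \<gamma>) = weighted_seminorm smul T S f \<alpha> q \<gamma>"
    and wnorm_upper: "x \<in> S \<Longrightarrow> f x * q (D \<alpha> \<gamma> x) \<le> wnorm f \<alpha> q \<gamma>"
    and wnorm_least: "0 \<le> c \<Longrightarrow> (\<And>x. x \<in> S \<Longrightarrow> f x * q (D \<alpha> \<gamma> x) \<le> c) \<Longrightarrow> wnorm f \<alpha> q \<gamma> \<le> c"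
proof -
  show eq: "ennreal (wnorm f \<alpha> q \<gamma>) = weighted_seminorm smul T S f \<alpha> q \<gamma>"
    using assms unfolding wnorm_def weighted_Ck_def by simp
  have le_iff: "wnorm f \<alpha> q \<gamma> \<le> c \<longleftrightarrow> (\<forall>x\<in>S. f x * q (D \<alpha> \<gamma> x) \<le> c)" if "0 \<le> c" for c
  proof -
    have "wnorm f \<alpha> q \<gamma> \<le> c \<longleftrightarrow> ennreal (wnorm f \<alpha> q \<gamma>) \<le> ennreal c"
      using that by (simp add: ennreal_le_iff)
    then show ?thesis
      unfolding eq weighted_seminorm_def SUP_ennreal_le_iff[OF that] .
  qed
  show "x \<in> S \<Longrightarrow> f x * q (D \<alpha> \<gamma> x) \<le> wnorm f \<alpha> q \<gamma>"
    using le_iff[of "wnorm f \<alpha> q \<gamma>"] by (simp add: wnorm_def)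
  show "0 \<le> c \<Longrightarrow> (\<And>x. x \<in> S \<Longrightarrow> f x * q (D \<alpha> \<gamma> x) \<le> c) \<Longrightarrow> wnorm f \<alpha> q \<gamma> \<le> c"
    using le_iff by blast
qed

lemma wnorm_nonneg: "0 \<le> wnorm f \<alpha> q \<gamma>"
  by (simp add: wnorm_def)

lemma zero_in_weighted_Ck: "0 \<in> X"
proof -
  have multi: "is_multi_deriv smul T S \<alpha> 0 0" for \<alpha>
  proof -
    have "has_iterated_deriv smul T (interior S) (index_list \<alpha>) 0 ((\<lambda>_. 0) \<alpha>)"
      by (rule has_iterated_deriv_family[where l = \<infinity>])
        (auto simp: has_partial_deriv_def topspace_0)
    then show ?thesis by (simp add: is_multi_deriv_def zero_fun_def topspace_0)
  qed
  then have D: "D \<alpha> 0 = 0" for \<alpha>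
    using multi_deriv_eq[OF dense multi] by (simp add: fun_eq_iff)
  have "\<exists>c\<ge>0. \<forall>x\<in>S. f x * q (D \<alpha> 0 x) \<le> c" if q: "q \<in> continuous_seminorms smul T" for f q \<alpha>
  proof -
    interpret q: seminormed_subspace smul "topspace T" q by (rule seminormed_subspace_topspace[OF q])
    show ?thesis by (intro exI[of _ 0]) (simp add: D)
  qed
  moreover have "Ck_on smul T k S 0"
    unfolding Ck_on_def using multi by (auto simp: zero_fun_def topspace_0)
  ultimately show ?thesis
    unfolding mem_weighted_Ck_iff by simp
qed

lemma add_in_weighted_Ck:
  assumes \<gamma>: "\<gamma> \<in> X" and \<eta>: "\<eta> \<in> X" shows "\<gamma> + \<eta> \<in> X"
  unfolding mem_weighted_Ck_iff
proof (intro conjI ballI allI impI)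
  show "Ck_on smul T k S (\<gamma> + \<eta>)"
    by (rule Ck_on_add(1)[OF dense Ck_on_weighted_Ck Ck_on_weighted_Ck, OF assms])
  show "(\<gamma> + \<eta>) x = 0" if "x \<notin> S" for x
    using that assms by (simp add: weighted_Ck_outside)
  fix f q and \<alpha> :: "'n \<Rightarrow> nat" assume f: "f \<in> W" and q: "q \<in> continuous_seminorms smul T" and \<alpha>: "mi_order \<alpha> \<le> k"
  interpret q: seminormed_subspace smul "topspace T" q by (rule seminormed_subspace_topspace[OF q])
  have "f x * q (D \<alpha> (\<gamma> + \<eta>) x) \<le> wnorm f \<alpha> q \<gamma> + wnorm f \<alpha> q \<eta>" if x: "x \<in> S" for x
  proof -
    have "f x * q (D \<alpha> (\<gamma> + \<eta>) x) \<le> f x * (q (D \<alpha> \<gamma> x) + q (D \<alpha> \<eta> x))"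
      unfolding D_add[OF assms \<alpha>] plus_fun_apply
      using x \<alpha> by (intro mult_left_mono q.triangle D_in_topspace weight_nonneg f assms)
    also have "\<dots> \<le> wnorm f \<alpha> q \<gamma> + wnorm f \<alpha> q \<eta>"
      unfolding distrib_left using x by (intro add_mono wnorm_upper assms f \<alpha> q)
    finally show ?thesis .
  qed
  then show "\<exists>c\<ge>0. \<forall>x\<in>S. f x * q (D \<alpha> (\<gamma> + \<eta>) x) \<le> c"
    using wnorm_nonneg by (meson add_nonneg_nonneg)
qed

lemma weighted_value_scale:
  assumes \<gamma>: "\<gamma> \<in> X" and q: "q \<in> continuous_seminorms smul T" and \<alpha>: "mi_order \<alpha> \<le> k" and x: "x \<in> S"
  shows "f x * q (D \<alpha> (fun_scale smul c \<gamma>) x) = norm c * (f x * q (D \<alpha> \<gamma> x))"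
proof -
  interpret q: seminormed_subspace smul "topspace T" q by (rule seminormed_subspace_topspace[OF q])
  show ?thesis
    unfolding D_scale[OF \<gamma> \<alpha>] using D_in_topspace[OF \<gamma> \<alpha> x]
    by (simp add: fun_scale_def q.homogeneous)
qed

lemma D_zero: "mi_order \<alpha> \<le> k \<Longrightarrow> D \<alpha> 0 = 0"
  using D_add[OF zero_in_weighted_Ck zero_in_weighted_Ck, of \<alpha>] by simp

lemma scale_in_weighted_Ck:
  assumes \<gamma>: "\<gamma> \<in> X" shows "fun_scale smul c \<gamma> \<in> X"
  unfolding mem_weighted_Ck_iff
proof (intro conjI ballI allI impI)
  show "Ck_on smul T k S (fun_scale smul c \<gamma>)"
    by (rule Ck_on_scale(1)[OF dense Ck_on_weighted_Ck, OF assms])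
  show "fun_scale smul c \<gamma> x = 0" if "x \<notin> S" for x
    using that assms by (simp add: weighted_Ck_outside fun_scale_def)
  fix f q and \<alpha> :: "'n \<Rightarrow> nat" assume f: "f \<in> W" and q: "q \<in> continuous_seminorms smul T" and \<alpha>: "mi_order \<alpha> \<le> k"
  have "\<forall>x\<in>S. f x * q (D \<alpha> (fun_scale smul c \<gamma>) x) \<le> norm c * wnorm f \<alpha> q \<gamma>"
    by (auto simp: weighted_value_scale[OF \<gamma> q \<alpha>] intro!: mult_left_mono wnorm_upper[OF \<gamma> f \<alpha> q])
  then show "\<exists>c'\<ge>0. \<forall>x\<in>S. f x * q (D \<alpha> (fun_scale smul c \<gamma>) x) \<le> c'"
    using wnorm_nonneg by (meson norm_ge_zero mult_nonneg_nonneg)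
qed

lemma subspace_weighted_Ck: "fun_scale.subspace X"
  by (rule fun_scale.subspaceI) (auto simp: zero_in_weighted_Ck add_in_weighted_Ck scale_in_weighted_Ck)

lemma seminorm_on_wnorm:
  assumes f: "f \<in> W" and \<alpha>: "mi_order \<alpha> \<le> k" and q: "q \<in> continuous_seminorms smul T"
  shows "seminorm_on (fun_scale smul) X (wnorm f \<alpha> q)"
proof -
  interpret q: seminormed_subspace smul "topspace T" q by (rule seminormed_subspace_topspace[OF q])
  have add: "wnorm f \<alpha> q (\<gamma> + \<eta>) \<le> wnorm f \<alpha> q \<gamma> + wnorm f \<alpha> q \<eta>" if \<gamma>: "\<gamma> \<in> X" and \<eta>: "\<eta> \<in> X" for \<gamma> \<eta>
  proof (rule wnorm_least[OF add_in_weighted_Ck[OF \<gamma> \<eta>] f \<alpha> q])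
    fix x assume x: "x \<in> S"
    have "f x * q (D \<alpha> (\<gamma> + \<eta>) x) \<le> f x * (q (D \<alpha> \<gamma> x) + q (D \<alpha> \<eta> x))"
      unfolding D_add[OF \<gamma> \<eta> \<alpha>] plus_fun_apply
      using x \<alpha> by (intro mult_left_mono q.triangle D_in_topspace weight_nonneg f \<gamma> \<eta>)
    also have "\<dots> \<le> wnorm f \<alpha> q \<gamma> + wnorm f \<alpha> q \<eta>"
      unfolding distrib_left using x by (intro add_mono wnorm_upper \<gamma> \<eta> f \<alpha> q)
    finally show "f x * q (D \<alpha> (\<gamma> + \<eta>) x) \<le> wnorm f \<alpha> q \<gamma> + wnorm f \<alpha> q \<eta>" .
  qed (simp add: wnorm_nonneg)
  have le: "wnorm f \<alpha> q (fun_scale smul c \<gamma>) \<le> norm c * wnorm f \<alpha> q \<gamma>" if \<gamma>: "\<gamma> \<in> X" for c \<gamma>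
    by (rule wnorm_least[OF scale_in_weighted_Ck[OF \<gamma>] f \<alpha> q])
      (auto simp: wnorm_nonneg weighted_value_scale[OF \<gamma> q \<alpha>] intro!: mult_left_mono wnorm_upper[OF \<gamma> f \<alpha> q])
  have "wnorm f \<alpha> q (fun_scale smul c \<gamma>) = norm c * wnorm f \<alpha> q \<gamma>" if \<gamma>: "\<gamma> \<in> X" for c \<gamma>
  proof (cases "c = 0")
    case True
    then show ?thesis using le[OF \<gamma>, of c] wnorm_nonneg[of f \<alpha> q "fun_scale smul c \<gamma>"] by simp
  next
    case False
    have "wnorm f \<alpha> q \<gamma> \<le> norm (inverse c) * wnorm f \<alpha> q (fun_scale smul c \<gamma>)"
      using le[OF scale_in_weighted_Ck[OF \<gamma>], of "inverse c" c] False by simp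
    then have "wnorm f \<alpha> q \<gamma> \<le> wnorm f \<alpha> q (fun_scale smul c \<gamma>) / norm c"
      by (simp add: norm_inverse divide_inverse mult.commute)
    then have "norm c * wnorm f \<alpha> q \<gamma> \<le> wnorm f \<alpha> q (fun_scale smul c \<gamma>)"
      using False by (simp add: pos_le_divide_eq mult.commute)
    with le[OF \<gamma>, of c] show ?thesis by simp
  qed
  with add show ?thesis by (simp add: seminorm_on_def wnorm_nonneg)
qed

lemma zero_seminorm: "(\<lambda>_. 0) \<in> continuous_seminorms smul T"
  by (simp add: continuous_seminorms_def)

sublocale wnorms: seminorm_family "fun_scale smul" X wnorms
proof
  obtain f where "f \<in> W" using weights by (auto simp: set_of_weights_def)
  then have "wnorm f (\<lambda>_. 0) (\<lambda>_. 0) \<in> wnorms"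
    unfolding wnorms_def using zero_seminorm
    by (intro CollectI exI[of _ f] exI[of _ "\<lambda>_. 0"]) (auto simp: mi_order_zero)
  then show "wnorms \<noteq> {}" by blast
qed (auto simp: subspace_weighted_Ck wnorms_def seminorm_on_wnorm)

lemma wnorms_memI:
  "f \<in> W \<Longrightarrow> mi_order \<alpha> \<le> k \<Longrightarrow> q \<in> continuous_seminorms smul T \<Longrightarrow> wnorm f \<alpha> q \<in> wnorms"
  by (auto simp: wnorms_def)

lemma weighted_Ck_topology_eq: "weighted_Ck_topology smul T k S W = seminorm_topology X wnorms"
proof -
  have ball: "{\<eta> \<in> X. weighted_seminorm smul T S f \<alpha> q (\<eta> - \<gamma>) < ennreal \<epsilon>} =
      {\<eta> \<in> X. wnorm f \<alpha> q (\<eta> - \<gamma>) < \<epsilon>}"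
    if "f \<in> W" "mi_order \<alpha> \<le> k" "q \<in> continuous_seminorms smul T" "\<gamma> \<in> X" for f \<alpha> q \<gamma> \<epsilon>
    using that ennreal_wnorm[OF wnorms.mem_X(3)[OF _ \<open>\<gamma> \<in> X\<close>], symmetric]
    by (auto simp: ennreal_less_iff wnorm_nonneg)
  have "{{\<eta> \<in> X. weighted_seminorm smul T S f \<alpha> q (\<eta> - \<gamma>) < ennreal \<epsilon>}
      | f \<alpha> q \<gamma> \<epsilon>. f \<in> W \<and> mi_order \<alpha> \<le> k \<and> q \<in> continuous_seminorms smul T \<and> \<gamma> \<in> X \<and> 0 < \<epsilon>} =
    {{\<eta> \<in> X. p (\<eta> - \<gamma>) < \<epsilon>} | p \<gamma> \<epsilon>. p \<in> wnorms \<and> \<gamma> \<in> X \<and> 0 < \<epsilon>}" (is "?A = ?B")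
  proof (intro set_eqI iffI)
    fix N assume "N \<in> ?A"
    then obtain f \<alpha> q \<gamma> \<epsilon> where "N = {\<eta> \<in> X. weighted_seminorm smul T S f \<alpha> q (\<eta> - \<gamma>) < ennreal \<epsilon>}"
      and *: "f \<in> W" "mi_order \<alpha> \<le> k" "q \<in> continuous_seminorms smul T" "\<gamma> \<in> X" "0 < \<epsilon>" by blast
    then have "N = {\<eta> \<in> X. wnorm f \<alpha> q (\<eta> - \<gamma>) < \<epsilon>}" using ball[OF *(1-4)] by simp
    then show "N \<in> ?B" using wnorms_memI[OF *(1-3)] *(4,5) by blast
  next
    fix N assume "N \<in> ?B"
    then obtain f \<alpha> q \<gamma> \<epsilon> where "N = {\<eta> \<in> X. wnorm f \<alpha> q (\<eta> - \<gamma>) < \<epsilon>}"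
      and *: "f \<in> W" "mi_order \<alpha> \<le> k" "q \<in> continuous_seminorms smul T" "\<gamma> \<in> X" "0 < \<epsilon>"
      unfolding wnorms_def by blast
    then have "N = {\<eta> \<in> X. weighted_seminorm smul T S f \<alpha> q (\<eta> - \<gamma>) < ennreal \<epsilon>}"
      using ball[OF *(1-4)] by simp
    then show "N \<in> ?A" using * by blast
  qed
  then show ?thesis by (simp add: weighted_Ck_topology_def seminorm_topology_def)
qed

lemma D_diff:
  assumes "\<gamma> \<in> X" "\<eta> \<in> X" "mi_order \<alpha> \<le> k" shows "D \<alpha> (\<gamma> - \<eta>) = D \<alpha> \<gamma> - D \<alpha> \<eta>"
  using D_add[OF wnorms.mem_X(3)[OF assms(1,2)] assms(2,3)] by (simp add: eq_diff_eq)

abbreviation \<T> :: "((real, 'n) vec \<Rightarrow> 'e) topology" where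
  "\<T> \<equiv> weighted_Ck_topology smul T k S W"

lemma topspace_weighted_Ck_topology: "topspace \<T> = X"
  by (simp add: weighted_Ck_topology_eq wnorms.topspace_seminorm_topology)

lemma hausdorff_weighted_Ck_topology: "hausdorff_locally_convex_space (fun_scale smul) \<T>"
proof -
  have "Hausdorff_space (seminorm_topology X wnorms)"
  proof (rule wnorms.Hausdorff_seminorm_topology)
    fix \<gamma> assume \<gamma>: "\<gamma> \<in> X" and zero: "\<forall>p\<in>wnorms. p \<gamma> = 0"
    have "\<gamma> x = 0" if x: "x \<in> S" for x
    proof (rule seminorms_separate)
      show \<gamma>x: "\<gamma> x \<in> topspace T" by (rule Ck_on_in_topspace[OF dense Ck_on_weighted_Ck[OF \<gamma>] x])
      fix q assume q: "q \<in> continuous_seminorms smul T"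
      interpret q: seminormed_subspace smul "topspace T" q by (rule seminormed_subspace_topspace[OF q])
      obtain f where f: "f \<in> W" "0 < f x" using ex_positive_weight[OF x] by blast
      have "wnorm f (\<lambda>_. 0) q \<gamma> = 0"
        using zero wnorms_memI[OF f(1) _ q, of "\<lambda>_. 0"] by (auto simp: mi_order_zero)
      then have "f x * q (\<gamma> x) \<le> 0"
        using wnorm_upper[OF \<gamma> f(1) _ q x, of "\<lambda>_. 0"]
        by (simp add: D_zero_index[OF \<gamma>] mi_order_zero)
      then show "q (\<gamma> x) = 0"
        using f(2) q.nonneg[OF \<gamma>x] by (simp add: mult_le_0_iff)
    qed
    then show "\<gamma> = 0" using weighted_Ck_outside[OF \<gamma>] by (auto simp: fun_eq_iff)
  qed
  then show ?thesis
    unfolding weighted_Ck_topology_eq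
    using wnorms.locally_convex_seminorm_topology
    by (simp add: hausdorff_locally_convex_space_def hausdorff_locally_convex_space_axioms_def)
qed

lemma continuous_seminorm_wnorm:
  "f \<in> W \<Longrightarrow> mi_order \<alpha> \<le> k \<Longrightarrow> q \<in> continuous_seminorms smul T \<Longrightarrow>
    wnorm f \<alpha> q \<in> continuous_seminorms (fun_scale smul) \<T>"
  unfolding weighted_Ck_topology_eq by (intro wnorms.continuous_seminorm_P wnorms_memI)

text \<open>A weight that is positive at \<open>x\<close> bounds the value of a derivative at \<open>x\<close> by a multiple
  of a weighted seminorm.\<close>

lemma continuous_map_eval_D:
  assumes \<alpha>: "mi_order \<alpha> \<le> k" and x: "x \<in> S"
  shows "continuous_map \<T> T (\<lambda>\<gamma>. D \<alpha> \<gamma> x)"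
  unfolding continuous_map_atin topspace_weighted_Ck_topology
proof
  interpret X: hausdorff_locally_convex_space "fun_scale smul" \<T>
    by (rule hausdorff_weighted_Ck_topology)
  fix \<gamma> assume \<gamma>: "\<gamma> \<in> X"
  have "limitin \<T> (\<lambda>\<eta>. \<eta>) \<gamma> (atin \<T> \<gamma>)"
    using \<gamma> continuous_map_id[of \<T>] unfolding continuous_map_atin
    by (auto simp: topspace_weighted_Ck_topology id_def)
  then have ev: "\<forall>\<^sub>F \<eta> in atin \<T> \<gamma>. \<eta> \<in> X"
    and lim: "\<And>f q. f \<in> W \<Longrightarrow> q \<in> continuous_seminorms smul T \<Longrightarrow>
      ((\<lambda>\<eta>. wnorm f \<alpha> q (\<eta> - \<gamma>)) \<longlongrightarrow> 0) (atin \<T> \<gamma>)"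
    using continuous_seminorm_wnorm[OF _ \<alpha>]
    by (auto simp: X.limitin_iff_seminorms topspace_weighted_Ck_topology)
  have "((\<lambda>\<eta>. q (D \<alpha> \<eta> x - D \<alpha> \<gamma> x)) \<longlongrightarrow> 0) (atin \<T> \<gamma>)"
    if q: "q \<in> continuous_seminorms smul T" for q
  proof -
    interpret q: seminormed_subspace smul "topspace T" q by (rule seminormed_subspace_topspace[OF q])
    obtain f where f: "f \<in> W" "0 < f x" using ex_positive_weight[OF x] by blast
    show ?thesis
    proof (rule Lim_null_comparison)
      show "\<forall>\<^sub>F \<eta> in atin \<T> \<gamma>. norm (q (D \<alpha> \<eta> x - D \<alpha> \<gamma> x)) \<le> wnorm f \<alpha> q (\<eta> - \<gamma>) / f x"
        using ev
      proof eventually_elim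
        case (elim \<eta>)
        have "f x * q (D \<alpha> \<eta> x - D \<alpha> \<gamma> x) \<le> wnorm f \<alpha> q (\<eta> - \<gamma>)"
          using wnorm_upper[OF wnorms.mem_X(3)[OF elim \<gamma>] f(1) \<alpha> q x] by (simp add: D_diff elim \<gamma> \<alpha>)
        then show ?case
          using f(2) elim \<gamma> by (simp add: pos_le_divide_eq mult.commute q.nonneg topspace_diff D_in_topspace \<alpha> x)
      qed
      show "((\<lambda>\<eta>. wnorm f \<alpha> q (\<eta> - \<gamma>) / f x) \<longlongrightarrow> 0) (atin \<T> \<gamma>)"
        using tendsto_divide[OF lim[OF f(1) q] tendsto_const, of "f x"] f(2) by simp
    qed
  qed
  then show "limitin T (\<lambda>\<gamma>. D \<alpha> \<gamma> x) (D \<alpha> \<gamma> x) (atin \<T> \<gamma>)"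
    unfolding limitin_iff_seminorms
    using ev \<gamma> by (auto simp: D_in_topspace \<alpha> x elim!: eventually_mono)
qed

end

section \<open>The exponential law\<close>

text \<open>The mean value inequality with slope \<open>g y\<close>: a difference quotient is as close to the
  derivative at \<open>y\<close> as the derivative is to being constant along the segment.\<close>

lemma (in locally_convex_space) difference_quotient_bound:
  assumes part: "has_partial_deriv smul T V i h g" and q: "q \<in> continuous_seminorms smul T"
    and t: "t \<noteq> 0" and V: "\<And>s. \<bar>s\<bar> \<le> \<bar>t\<bar> \<Longrightarrow> y + s *\<^sub>R axis i 1 \<in> V"
    and h: "\<And>x. x \<in> V \<Longrightarrow> h x \<in> topspace T"
    and M: "\<And>s. \<bar>s\<bar> \<le> \<bar>t\<bar> \<Longrightarrow> q (g (y + s *\<^sub>R axis i 1) - g y) \<le> M"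
  shows "q (smul (of_real (1 / t)) (h (y + t *\<^sub>R axis i 1) - h y) - g y) \<le> M"
proof -
  interpret q: seminormed_subspace smul "topspace T" q by (rule seminormed_subspace_topspace[OF q])
  define \<phi> where "\<phi> s = h (y + s *\<^sub>R axis i 1)" for s
  have lim: "limitin T (\<lambda>\<tau>. smul (of_real (1 / \<tau>)) (\<phi> (s + \<tau>) - \<phi> s)) (g (y + s *\<^sub>R axis i 1)) (at 0)"
    if "\<bar>s\<bar> \<le> \<bar>t\<bar>" for s
    using part V[OF that] by (auto simp: has_partial_deriv_def \<phi>_def algebra_simps)
  have c: "g y \<in> topspace T"
    using limitin_topspace[OF lim[of 0]] by simp
  have \<phi>: "\<phi> s \<in> topspace T" if "\<bar>s\<bar> \<le> \<bar>t\<bar>" for s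
    unfolding \<phi>_def by (rule h[OF V[OF that]])
  have main: "q (\<phi> t - \<phi> 0 - smul (of_real t) (g y)) \<le> M * \<bar>t\<bar>"
  proof (cases "0 < t")
    case True
    have "q (\<phi> t - \<phi> 0 - smul (of_real (t - 0)) (g y)) \<le> M * (t - 0)"
      using True by (intro mean_value_inequality[OF q _ \<phi> c lim M]) auto
    with True show ?thesis by simp
  next
    case False
    have "q (\<phi> 0 - \<phi> t - smul (of_real (0 - t)) (g y)) \<le> M * (0 - t)"
      using False by (intro mean_value_inequality[OF q _ \<phi> c lim M]) auto
    moreover have "\<phi> t - \<phi> 0 - smul (of_real t) (g y) = - (\<phi> 0 - \<phi> t - smul (of_real (0 - t)) (g y))"
      by simp
    moreover have "\<phi> 0 - \<phi> t - smul (of_real (0 - t)) (g y) \<in> topspace T"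
      by (intro topspace_diff topspace_scale \<phi> c) auto
    ultimately show ?thesis
      using False by (simp only: q.uminus) simp
  qed
  have "q (smul (of_real (1 / t)) (\<phi> t - \<phi> 0) - g y) =
      q (smul (of_real (1 / t)) (\<phi> t - \<phi> 0 - smul (of_real t) (g y)))"
    using t by (simp add: scale_right_diff_distrib)
  also have "\<dots> = q (\<phi> t - \<phi> 0 - smul (of_real t) (g y)) / \<bar>t\<bar>"
    using \<phi> c by (simp add: q.homogeneous topspace_diff topspace_scale norm_divide)
  also have "\<dots> \<le> M"
    using main t by (simp add: pos_divide_le_eq)
  finally show ?thesis by (simp add: \<phi>_def)
qed

lemma compact_tube:
  assumes "compact C" and
    "\<And>x. x \<in> C \<Longrightarrow> \<exists>A B. open A \<and> open B \<and> x \<in> A \<and> y \<in> B \<and> (\<forall>x'\<in>A. \<forall>y'\<in>B. P x' y')"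
  shows "\<exists>B. open B \<and> y \<in> B \<and> (\<forall>x\<in>C. \<forall>y'\<in>B. P x y')"
proof -
  have "\<forall>x\<in>C. \<exists>A. open A \<and> x \<in> A \<and> (\<exists>B. open B \<and> y \<in> B \<and> (\<forall>x'\<in>A. \<forall>y'\<in>B. P x' y'))"
  proof
    fix x assume "x \<in> C"
    from assms(2)[OF this]
    show "\<exists>A. open A \<and> x \<in> A \<and> (\<exists>B. open B \<and> y \<in> B \<and> (\<forall>x'\<in>A. \<forall>y'\<in>B. P x' y'))"
      by (elim exE conjE) (intro exI conjI)
  qed
  from bchoice[OF this] obtain A where A: "\<forall>x\<in>C. open (A x) \<and> x \<in> A x \<and>
      (\<exists>B. open B \<and> y \<in> B \<and> (\<forall>x'\<in>A x. \<forall>y'\<in>B. P x' y'))" ..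
  then have "\<forall>x\<in>C. \<exists>B. open B \<and> y \<in> B \<and> (\<forall>x'\<in>A x. \<forall>y'\<in>B. P x' y')" by simp
  from bchoice[OF this] obtain B
    where B: "\<forall>x\<in>C. open (B x) \<and> y \<in> B x \<and> (\<forall>x'\<in>A x. \<forall>y'\<in>B x. P x' y')" ..
  have "C \<subseteq> (\<Union>x\<in>C. A x)" using A by blast
  then obtain D where D: "D \<subseteq> C" "finite D" "C \<subseteq> (\<Union>x\<in>D. A x)"
    using compactE_image[OF assms(1), of C A] A by blast
  have "open (\<Inter>x\<in>D. B x)" "y \<in> (\<Inter>x\<in>D. B x)"
    using D B by (auto intro!: open_INT)
  moreover have "\<forall>x\<in>C. \<forall>y'\<in>(\<Inter>x\<in>D. B x). P x y'"
    using D B by blast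
  ultimately show ?thesis by blast
qed

text \<open>The properties of a weighted domain that the exponential law uses. They hold both for the open
  set and for the compact convex set, so both directions of the homeomorphism are instances of
  one statement. The local lower bound makes evaluation jointly continuous; boundedness on
  compact sets and the o-condition together turn joint continuity into convergence in the
  weighted seminorms.\<close>

definition admissible_weights :: "(real, 'n::finite) vec set \<Rightarrow> ((real, 'n) vec \<Rightarrow> real) set \<Rightarrow> bool" where
  "admissible_weights S W \<longleftrightarrow>
     S \<subseteq> closure (interior S) \<and> set_of_weights S W \<and> o_condition S W \<and>
     (\<forall>x\<in>S. \<exists>f\<in>W. \<exists>c>0. \<exists>N. open N \<and> x \<in> N \<and> (\<forall>y\<in>S \<inter> N. c \<le> f y)) \<and>
     (\<forall>f\<in>W. \<forall>C\<subseteq>S. compact C \<longrightarrow> (\<exists>b. \<forall>x\<in>C. f x \<le> b))"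

locale exponential_law = hausdorff_locally_convex_space smul T
  for smul :: "'k::real_normed_field \<Rightarrow> 'e::ab_group_add \<Rightarrow> 'e" and T +
  fixes S1 :: "(real, 'n::{finite,linorder}) vec set" and k :: enat
    and W1 :: "((real, 'n) vec \<Rightarrow> real) set"
    and S2 :: "(real, 'm::{finite,linorder}) vec set" and l :: enat
    and W2 :: "((real, 'm) vec \<Rightarrow> real) set"
  assumes adm1: "admissible_weights S1 W1" and adm2: "admissible_weights S2 W2"
begin

sublocale X1: weighted_Ck_space smul T S1 k W1
  using adm1 by unfold_locales (auto simp: admissible_weights_def)

sublocale X2: weighted_Ck_space smul T S2 l W2
  using adm2 by unfold_locales (auto simp: admissible_weights_def)

sublocale X12: weighted_Ck_space "fun_scale smul" X2.\<T> S1 k W1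
  using X2.hausdorff_weighted_Ck_topology X1.dense X1.weights
  by (simp add: weighted_Ck_space_def weighted_Ck_space_axioms_def)

sublocale X21: weighted_Ck_space "fun_scale smul" X1.\<T> S2 l W2
  using X1.hausdorff_weighted_Ck_topology X2.dense X2.weights
  by (simp add: weighted_Ck_space_def weighted_Ck_space_axioms_def)

definition mixed_deriv :: "('n \<Rightarrow> nat) \<Rightarrow> ('m \<Rightarrow> nat) \<Rightarrow> ((real, 'n) vec \<Rightarrow> (real, 'm) vec \<Rightarrow> 'e) \<Rightarrow>
    (real, 'n) vec \<Rightarrow> (real, 'm) vec \<Rightarrow> 'e" where
  "mixed_deriv \<alpha> \<beta> \<gamma> x y = X2.D \<beta> (X12.D \<alpha> \<gamma> x) y"

text \<open>For fixed \<open>y\<close> this is the \<open>\<beta>\<close>-th derivative of all sections \<open>\<gamma> x\<close>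
  at \<open>y\<close>; it will be the \<open>\<beta>\<close>-th derivative of the flipped map at \<open>y\<close>.
  The arguments are ordered so that it is a map into the functions of \<open>x\<close>.\<close>

definition section_deriv :: "('m \<Rightarrow> nat) \<Rightarrow> ((real, 'n) vec \<Rightarrow> (real, 'm) vec \<Rightarrow> 'e) \<Rightarrow>
    (real, 'm) vec \<Rightarrow> (real, 'n) vec \<Rightarrow> 'e" where
  "section_deriv \<beta> \<gamma> y x = X2.D \<beta> (\<gamma> x) y"

context
  fixes \<gamma> assumes \<gamma>: "\<gamma> \<in> X12.X"
begin

lemma D_in_X2: "mi_order \<alpha> \<le> k \<Longrightarrow> x \<in> S1 \<Longrightarrow> X12.D \<alpha> \<gamma> x \<in> X2.X"
  using X12.D_in_topspace[OF \<gamma>] by (simp add: X2.topspace_weighted_Ck_topology)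

lemma value_in_X2: "\<gamma> x \<in> X2.X"
proof (cases "x \<in> S1")
  case True
  then show ?thesis
    using D_in_X2[of "\<lambda>_. 0"] by (simp add: X12.D_zero_index[OF \<gamma>] mi_order_zero)
next
  case False
  then show ?thesis
    using X12.weighted_Ck_outside[OF \<gamma>] X2.zero_in_weighted_Ck by simp
qed

lemma mixed_deriv_in_topspace:
  "mi_order \<alpha> \<le> k \<Longrightarrow> mi_order \<beta> \<le> l \<Longrightarrow> x \<in> S1 \<Longrightarrow> y \<in> S2 \<Longrightarrow> mixed_deriv \<alpha> \<beta> \<gamma> x y \<in> topspace T"
  unfolding mixed_deriv_def by (intro X2.D_in_topspace D_in_X2)

lemma mixed_deriv_bound:
  assumes "f1 \<in> W1" "f2 \<in> W2" "mi_order \<alpha> \<le> k" "mi_order \<beta> \<le> l" "q \<in> continuous_seminorms smul T"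
    and x: "x \<in> S1" and y: "y \<in> S2"
  shows "f1 x * (f2 y * q (mixed_deriv \<alpha> \<beta> \<gamma> x y)) \<le> X12.wnorm f1 \<alpha> (X2.wnorm f2 \<beta> q) \<gamma>"
proof -
  have "f1 x * (f2 y * q (mixed_deriv \<alpha> \<beta> \<gamma> x y)) \<le> f1 x * X2.wnorm f2 \<beta> q (X12.D \<alpha> \<gamma> x)"
    unfolding mixed_deriv_def
    by (intro mult_left_mono X2.wnorm_upper D_in_X2 X1.weight_nonneg assms)
  also have "\<dots> \<le> X12.wnorm f1 \<alpha> (X2.wnorm f2 \<beta> q) \<gamma>"
    by (intro X12.wnorm_upper \<gamma> X2.continuous_seminorm_wnorm assms)
  finally show ?thesis .
qed

text \<open>Taking the \<open>\<beta>\<close>-th derivative at \<open>y\<close> is a continuous linear map on the inner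
  weighted space, so it commutes with the derivatives in \<open>x\<close>.\<close>

lemma section_is_multi_deriv:
  assumes \<alpha>: "mi_order \<alpha> \<le> k" and \<beta>: "mi_order \<beta> \<le> l" and y: "y \<in> S2"
  shows "is_multi_deriv smul T S1 \<alpha> (section_deriv \<beta> \<gamma> y) (\<lambda>x. mixed_deriv \<alpha> \<beta> \<gamma> x y)"
  unfolding mixed_deriv_def section_deriv_def
proof (rule X12.is_multi_deriv_linear_image[OF vector_space_axioms X2.continuous_map_eval_D[OF \<beta> y]])
  show "is_multi_deriv (fun_scale smul) X2.\<T> S1 \<alpha> \<gamma> (X12.D \<alpha> \<gamma>)"
    by (rule X12.Ck_on_multi_deriv[OF X1.dense X12.Ck_on_weighted_Ck[OF \<gamma>] \<alpha>])
qed (auto simp: X2.topspace_weighted_Ck_topology X2.D_add X2.D_scale_apply \<beta>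
    intro: value_in_X2)

lemma section_in_X1:
  assumes \<beta>: "mi_order \<beta> \<le> l" and y: "y \<in> S2"
  shows "section_deriv \<beta> \<gamma> y \<in> X1.X"
  unfolding X1.mem_weighted_Ck_iff
proof (intro conjI ballI allI impI)
  have "section_deriv \<beta> \<gamma> y = (\<lambda>x. mixed_deriv (\<lambda>_. 0) \<beta> \<gamma> x y)"
    by (simp add: fun_eq_iff section_deriv_def mixed_deriv_def X12.D_zero_index[OF \<gamma>])
  then show "Ck_on smul T k S1 (section_deriv \<beta> \<gamma> y)"
    using section_is_multi_deriv[OF _ \<beta> y] section_is_multi_deriv[OF _ \<beta> y, of "\<lambda>_. 0"]
    by (auto simp: Ck_on_def is_multi_deriv_def[of _ _ _ "\<lambda>_. 0"] mi_order_zero)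
  show "section_deriv \<beta> \<gamma> y x = 0" if "x \<notin> S1" for x
    using that by (simp add: section_deriv_def X12.weighted_Ck_outside[OF \<gamma>] X2.D_zero \<beta>)
  fix f1 q and \<alpha> :: "'n \<Rightarrow> nat"
  assume f1: "f1 \<in> W1" and q: "q \<in> continuous_seminorms smul T" and \<alpha>: "mi_order \<alpha> \<le> k"
  obtain f2 where f2: "f2 \<in> W2" "0 < f2 y" using X2.ex_positive_weight[OF y] by blast
  have "f1 x * q (X1.D \<alpha> (section_deriv \<beta> \<gamma> y) x) \<le> X12.wnorm f1 \<alpha> (X2.wnorm f2 \<beta> q) \<gamma> / f2 y"
    if x: "x \<in> S1" for x
    using mixed_deriv_bound[OF f1 f2(1) \<alpha> \<beta> q x y] f2(2) x
    by (simp add: multi_deriv_eq[OF X1.dense section_is_multi_deriv[OF \<alpha> \<beta> y]] pos_le_divide_eq mult_ac)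
  then show "\<exists>c\<ge>0. \<forall>x\<in>S1. f1 x * q (X1.D \<alpha> (section_deriv \<beta> \<gamma> y) x) \<le> c"
    using X12.wnorm_nonneg f2(2)
    by (intro exI[of _ "X12.wnorm f1 \<alpha> (X2.wnorm f2 \<beta> q) \<gamma> / f2 y"]) auto
qed

lemma D_section:
  assumes "mi_order \<alpha> \<le> k" "mi_order \<beta> \<le> l" "y \<in> S2" "x \<in> S1"
  shows "X1.D \<alpha> (section_deriv \<beta> \<gamma> y) x = mixed_deriv \<alpha> \<beta> \<gamma> x y"
  using multi_deriv_eq[OF X1.dense section_is_multi_deriv[OF assms(1-3)]] assms(4) by simp

text \<open>Every term of the supremum over \<open>x\<close> on the left becomes, with the factor \<open>f2 y\<close>, a
  term of the iterated supremum on the right.\<close>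

lemma wnorm_section_bound:
  assumes f1: "f1 \<in> W1" and f2: "f2 \<in> W2" and \<alpha>: "mi_order \<alpha> \<le> k" and \<beta>: "mi_order \<beta> \<le> l"
    and q: "q \<in> continuous_seminorms smul T" and y: "y \<in> S2"
  shows "f2 y * X1.wnorm f1 \<alpha> q (section_deriv \<beta> \<gamma> y) \<le> X12.wnorm f1 \<alpha> (X2.wnorm f2 \<beta> q) \<gamma>"
proof (cases "f2 y = 0")
  case True
  then show ?thesis by (simp add: X12.wnorm_nonneg)
next
  case False
  then have pos: "0 < f2 y" using X2.weight_nonneg[OF f2 y] by simp
  have "X1.wnorm f1 \<alpha> q (section_deriv \<beta> \<gamma> y) \<le> X12.wnorm f1 \<alpha> (X2.wnorm f2 \<beta> q) \<gamma> / f2 y"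
  proof (rule X1.wnorm_least[OF section_in_X1[OF \<beta> y] f1 \<alpha> q])
    fix x assume x: "x \<in> S1"
    show "f1 x * q (X1.D \<alpha> (section_deriv \<beta> \<gamma> y) x) \<le> X12.wnorm f1 \<alpha> (X2.wnorm f2 \<beta> q) \<gamma> / f2 y"
      using mixed_deriv_bound[OF f1 f2 \<alpha> \<beta> q x y] pos
      by (simp add: D_section[OF \<alpha> \<beta> y x] pos_le_divide_eq mult_ac)
  qed (use pos X12.wnorm_nonneg in simp)
  then show ?thesis using pos by (simp add: pos_le_divide_eq mult.commute)
qed

text \<open>Moving \<open>x\<close> changes the derivative uniformly for \<open>y\<close> near \<open>y0\<close>, since
  some weight of the second domain stays away from 0 there; moving \<open>y\<close> at the fixed point
  \<open>x0\<close> is plain continuity.\<close>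

lemma mixed_deriv_jointly_continuous:
  assumes \<alpha>: "mi_order \<alpha> \<le> k" and \<beta>: "mi_order \<beta> \<le> l" and q: "q \<in> continuous_seminorms smul T"
    and x0: "x0 \<in> S1" and y0: "y0 \<in> S2" and e: "0 < e"
  shows "\<exists>A B. open A \<and> open B \<and> x0 \<in> A \<and> y0 \<in> B \<and>
    (\<forall>x\<in>S1 \<inter> A. \<forall>y\<in>S2 \<inter> B. q (mixed_deriv \<alpha> \<beta> \<gamma> x y - mixed_deriv \<alpha> \<beta> \<gamma> x0 y0) < e)"
proof -
  interpret q: seminormed_subspace smul "topspace T" q by (rule seminormed_subspace_topspace[OF q])
  obtain f2 c N where f2: "f2 \<in> W2" and c: "0 < c" and N: "open N" "y0 \<in> N" "\<And>y. y \<in> S2 \<inter> N \<Longrightarrow> c \<le> f2 y"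
    using adm2 y0 unfolding admissible_weights_def by meson
  have "is_multi_deriv (fun_scale smul) X2.\<T> S1 \<alpha> \<gamma> (X12.D \<alpha> \<gamma>)"
    by (rule X12.Ck_on_multi_deriv[OF X1.dense X12.Ck_on_weighted_Ck[OF \<gamma>] \<alpha>])
  then have "((\<lambda>x. X2.wnorm f2 \<beta> q (X12.D \<alpha> \<gamma> x - X12.D \<alpha> \<gamma> x0)) \<longlongrightarrow> 0) (at x0 within S1)"
    using X2.continuous_seminorm_wnorm[OF f2 \<beta> q] x0
    by (simp add: is_multi_deriv_def X12.continuous_map_top_of_set_iff)
  then have "\<forall>\<^sub>F x in at x0 within S1. X2.wnorm f2 \<beta> q (X12.D \<alpha> \<gamma> x - X12.D \<alpha> \<gamma> x0) < c * (e / 2)"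
    using c e by (intro order_tendstoD(2)[of _ 0]) auto
  then obtain A where A: "open A" "x0 \<in> A" and
    less: "\<And>x. x \<in> A \<Longrightarrow> x \<noteq> x0 \<Longrightarrow> x \<in> S1 \<Longrightarrow> X2.wnorm f2 \<beta> q (X12.D \<alpha> \<gamma> x - X12.D \<alpha> \<gamma> x0) < c * (e / 2)"
    unfolding eventually_at_topological by blast
  have "continuous_map (top_of_set S2) T (mixed_deriv \<alpha> \<beta> \<gamma> x0)"
    using Ck_on_multi_deriv[OF X2.dense X2.Ck_on_weighted_Ck[OF D_in_X2[OF \<alpha> x0]] \<beta>]
    by (simp add: is_multi_deriv_def mixed_deriv_def[abs_def])
  then have "((\<lambda>y. q (mixed_deriv \<alpha> \<beta> \<gamma> x0 y - mixed_deriv \<alpha> \<beta> \<gamma> x0 y0)) \<longlongrightarrow> 0) (at y0 within S2)"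
    using q y0 by (simp add: continuous_map_top_of_set_iff)
  then have "\<forall>\<^sub>F y in at y0 within S2. q (mixed_deriv \<alpha> \<beta> \<gamma> x0 y - mixed_deriv \<alpha> \<beta> \<gamma> x0 y0) < e / 2"
    using e by (intro order_tendstoD(2)[of _ 0]) auto
  then obtain B where B: "open B" "y0 \<in> B" and
    less': "\<And>y. y \<in> B \<Longrightarrow> y \<noteq> y0 \<Longrightarrow> y \<in> S2 \<Longrightarrow> q (mixed_deriv \<alpha> \<beta> \<gamma> x0 y - mixed_deriv \<alpha> \<beta> \<gamma> x0 y0) < e / 2"
    unfolding eventually_at_topological by blast
  have "q (mixed_deriv \<alpha> \<beta> \<gamma> x y - mixed_deriv \<alpha> \<beta> \<gamma> x0 y0) < e" if x: "x \<in> S1 \<inter> A" and y: "y \<in> S2 \<inter> (B \<inter> N)" for x y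
  proof -
    have xy: "x \<in> S1" "y \<in> S2" using x y by auto
    have "q (mixed_deriv \<alpha> \<beta> \<gamma> x y - mixed_deriv \<alpha> \<beta> \<gamma> x0 y) < e / 2"
    proof (cases "x = x0")
      case False
      have diff: "X12.D \<alpha> \<gamma> x - X12.D \<alpha> \<gamma> x0 \<in> X2.X"
        by (intro X2.wnorms.mem_X D_in_X2 \<alpha> xy x0)
      have "c * q (mixed_deriv \<alpha> \<beta> \<gamma> x y - mixed_deriv \<alpha> \<beta> \<gamma> x0 y) \<le> f2 y * q (mixed_deriv \<alpha> \<beta> \<gamma> x y - mixed_deriv \<alpha> \<beta> \<gamma> x0 y)"
        using N(3)[of y] y x x0 \<alpha> \<beta> by (intro mult_right_mono q.nonneg topspace_diff mixed_deriv_in_topspace) auto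
      also have "\<dots> \<le> X2.wnorm f2 \<beta> q (X12.D \<alpha> \<gamma> x - X12.D \<alpha> \<gamma> x0)"
        using X2.wnorm_upper[OF diff f2 \<beta> q xy(2)]
        by (simp add: mixed_deriv_def X2.D_diff[OF D_in_X2 D_in_X2] \<alpha> \<beta> xy x0)
      also have "\<dots> < c * (e / 2)" using less x False by blast
      finally show ?thesis using c by (simp only: mult_less_cancel_left_pos)
    qed (use e in simp)
    moreover have "q (mixed_deriv \<alpha> \<beta> \<gamma> x0 y - mixed_deriv \<alpha> \<beta> \<gamma> x0 y0) < e / 2"
      using less'[of y] y e by (cases "y = y0") auto
    moreover have "q (mixed_deriv \<alpha> \<beta> \<gamma> x y - mixed_deriv \<alpha> \<beta> \<gamma> x0 y0) \<le>
        q (mixed_deriv \<alpha> \<beta> \<gamma> x y - mixed_deriv \<alpha> \<beta> \<gamma> x0 y) + q (mixed_deriv \<alpha> \<beta> \<gamma> x0 y - mixed_deriv \<alpha> \<beta> \<gamma> x0 y0)"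
      by (intro q.triangle_via mixed_deriv_in_topspace \<alpha> \<beta> xy x0 y0)
    ultimately show ?thesis by simp
  qed
  with A B N(1,2) show ?thesis
    by (intro exI[of _ A] exI[of _ "B \<inter> N"]) auto
qed

text \<open>The o-condition enters here. Outside a compact set the weight \<open>f1\<close> is small against a
  weight \<open>g\<close> whose products with the derivatives are bounded by some \<open>M\<close>, uniformly for
  \<open>y\<close> near \<open>y0\<close>. On the compact set \<open>f1\<close> is bounded, and joint continuity is
  uniform in \<open>x\<close> by compactness.\<close>

lemma section_near:
  assumes f1: "f1 \<in> W1" and \<alpha>: "mi_order \<alpha> \<le> k" and \<beta>: "mi_order \<beta> \<le> l"
    and q: "q \<in> continuous_seminorms smul T" and y0: "y0 \<in> S2" and e: "0 < e"
  shows "\<exists>B. open B \<and> y0 \<in> B \<and> (\<forall>y\<in>S2 \<inter> B. \<forall>x\<in>S1. f1 x * q (mixed_deriv \<alpha> \<beta> \<gamma> x y - mixed_deriv \<alpha> \<beta> \<gamma> x y0) \<le> e)"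
proof -
  interpret q: seminormed_subspace smul "topspace T" q by (rule seminormed_subspace_topspace[OF q])
  obtain g where g: "g \<in> W1" "weight_little_o S1 f1 g"
    using adm1 f1 by (auto simp: admissible_weights_def o_condition_def)
  obtain f2 c N where f2: "f2 \<in> W2" and c: "0 < c" and N: "open N" "y0 \<in> N" "\<And>y. y \<in> S2 \<inter> N \<Longrightarrow> c \<le> f2 y"
    using adm2 y0 unfolding admissible_weights_def by meson
  define M where "M = X12.wnorm g \<alpha> (X2.wnorm f2 \<beta> q) \<gamma> / c"
  have M: "0 \<le> M" using c X12.wnorm_nonneg by (simp add: M_def)
  have gM: "g x * q (mixed_deriv \<alpha> \<beta> \<gamma> x y) \<le> M" if x: "x \<in> S1" and y: "y \<in> S2 \<inter> N" for x y
  proof -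
    have "c * (g x * q (mixed_deriv \<alpha> \<beta> \<gamma> x y)) \<le> f2 y * (g x * q (mixed_deriv \<alpha> \<beta> \<gamma> x y))"
      using N(3)[OF y] x y \<alpha> \<beta> g
      by (intro mult_right_mono mult_nonneg_nonneg X1.weight_nonneg q.nonneg mixed_deriv_in_topspace) auto
    also have "\<dots> \<le> X12.wnorm g \<alpha> (X2.wnorm f2 \<beta> q) \<gamma>"
      using mixed_deriv_bound[OF g(1) f2 \<alpha> \<beta> q x] y by (simp add: mult_ac)
    finally show ?thesis using c by (simp add: M_def pos_le_divide_eq mult_ac)
  qed
  \<comment> \<open>two values of the derivative, each at most \<open>M\<close> after weighting by \<open>g\<close>, must stay within \<open>e\<close>\<close>
  define d where "d = e / (2 * (M + 1))"
  have d: "0 < d" "d * (2 * M) \<le> e" using e M by (auto simp: d_def field_simps)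
  obtain C where C: "C \<subseteq> S1" "compact C" and outside: "\<And>x. x \<in> S1 - C \<Longrightarrow> f1 x \<le> d * g x"
    using g(2)[unfolded weight_little_o_def, rule_format, OF d(1)] by blast
  obtain b0 where b0: "\<And>x. x \<in> C \<Longrightarrow> f1 x \<le> b0"
    using adm1 f1 C unfolding admissible_weights_def by meson
  define b where "b = max b0 1"
  have b: "0 < b" "\<And>x. x \<in> C \<Longrightarrow> f1 x \<le> b" using b0 by (auto simp: b_def le_max_iff_disj)
  have "\<exists>B. open B \<and> y0 \<in> B \<and>
      (\<forall>x\<in>C. \<forall>y\<in>B. x \<in> S1 \<longrightarrow> y \<in> S2 \<longrightarrow> q (mixed_deriv \<alpha> \<beta> \<gamma> x y - mixed_deriv \<alpha> \<beta> \<gamma> x y0) < e / b)"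
  proof (rule compact_tube[OF C(2)])
    fix x0 assume "x0 \<in> C"
    then have x0: "x0 \<in> S1" using C(1) by blast
    have "0 < e / b / 2" using e b by simp
    from mixed_deriv_jointly_continuous[OF \<alpha> \<beta> q x0 y0 this] obtain A B
      where AB: "open A" "open B" "x0 \<in> A" "y0 \<in> B" and
        less: "\<And>x y. x \<in> S1 \<inter> A \<Longrightarrow> y \<in> S2 \<inter> B \<Longrightarrow> q (mixed_deriv \<alpha> \<beta> \<gamma> x y - mixed_deriv \<alpha> \<beta> \<gamma> x0 y0) < e / b / 2"
      by blast
    have "q (mixed_deriv \<alpha> \<beta> \<gamma> x y - mixed_deriv \<alpha> \<beta> \<gamma> x y0) < e / b"
      if x: "x \<in> A" "x \<in> S1" and y: "y \<in> B" "y \<in> S2" for x y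
    proof -
      have "q (mixed_deriv \<alpha> \<beta> \<gamma> x y - mixed_deriv \<alpha> \<beta> \<gamma> x y0) \<le>
          q (mixed_deriv \<alpha> \<beta> \<gamma> x y - mixed_deriv \<alpha> \<beta> \<gamma> x0 y0) + q (mixed_deriv \<alpha> \<beta> \<gamma> x0 y0 - mixed_deriv \<alpha> \<beta> \<gamma> x y0)"
        by (intro q.triangle_via mixed_deriv_in_topspace \<alpha> \<beta> x y x0 y0)
      moreover have "q (mixed_deriv \<alpha> \<beta> \<gamma> x0 y0 - mixed_deriv \<alpha> \<beta> \<gamma> x y0) = q (mixed_deriv \<alpha> \<beta> \<gamma> x y0 - mixed_deriv \<alpha> \<beta> \<gamma> x0 y0)"
        by (intro q.minus_commute mixed_deriv_in_topspace \<alpha> \<beta> x y x0 y0)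
      ultimately show ?thesis using less[of x y] less[of x y0] x y y0 AB by simp
    qed
    with AB show "\<exists>A B. open A \<and> open B \<and> x0 \<in> A \<and> y0 \<in> B \<and>
        (\<forall>x\<in>A. \<forall>y\<in>B. x \<in> S1 \<longrightarrow> y \<in> S2 \<longrightarrow> q (mixed_deriv \<alpha> \<beta> \<gamma> x y - mixed_deriv \<alpha> \<beta> \<gamma> x y0) < e / b)"
      by blast
  qed
  then obtain B where B: "open B" "y0 \<in> B" and
    near: "\<And>x y. x \<in> C \<Longrightarrow> x \<in> S1 \<Longrightarrow> y \<in> B \<Longrightarrow> y \<in> S2 \<Longrightarrow> q (mixed_deriv \<alpha> \<beta> \<gamma> x y - mixed_deriv \<alpha> \<beta> \<gamma> x y0) < e / b"
    by blast
  have "f1 x * q (mixed_deriv \<alpha> \<beta> \<gamma> x y - mixed_deriv \<alpha> \<beta> \<gamma> x y0) \<le> e" if x: "x \<in> S1" and y: "y \<in> S2 \<inter> (B \<inter> N)" for x y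
  proof (cases "x \<in> C")
    case True
    have "f1 x * q (mixed_deriv \<alpha> \<beta> \<gamma> x y - mixed_deriv \<alpha> \<beta> \<gamma> x y0) \<le> b * (e / b)"
      using near[OF True x, of y] b(1) b(2)[OF True] x y y0 \<alpha> \<beta>
      by (intro mult_mono q.nonneg topspace_diff mixed_deriv_in_topspace) auto
    then show ?thesis using b by simp
  next
    case False
    have "0 \<le> d * g x" using d(1) X1.weight_nonneg[OF g(1) x] by simp
    then have "f1 x * q (mixed_deriv \<alpha> \<beta> \<gamma> x y - mixed_deriv \<alpha> \<beta> \<gamma> x y0) \<le> (d * g x) * (q (mixed_deriv \<alpha> \<beta> \<gamma> x y) + q (mixed_deriv \<alpha> \<beta> \<gamma> x y0))"
      using outside[of x] False x y y0 \<alpha> \<beta>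
      by (intro mult_mono q.nonneg q.triangle_diff topspace_diff mixed_deriv_in_topspace) auto
    also have "\<dots> = d * (g x * q (mixed_deriv \<alpha> \<beta> \<gamma> x y) + g x * q (mixed_deriv \<alpha> \<beta> \<gamma> x y0))"
      by (simp add: algebra_simps)
    also have "\<dots> \<le> d * (M + M)"
      using gM[OF x, of y] gM[OF x, of y0] y y0 N(2) d(1) by (intro mult_left_mono add_mono) auto
    also have "\<dots> \<le> e" using d(2) by simp
    finally show ?thesis .
  qed
  with B N(1,2) show ?thesis by (intro exI[of _ "B \<inter> N"]) auto
qed

lemma wnorm_section_diff_le:
  assumes f1: "f1 \<in> W1" and \<alpha>: "mi_order \<alpha> \<le> k" and \<beta>: "mi_order \<beta> \<le> l"
    and q: "q \<in> continuous_seminorms smul T" and y: "y \<in> S2" "y0 \<in> S2" and e: "0 \<le> e"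
    and le: "\<And>x. x \<in> S1 \<Longrightarrow> f1 x * q (mixed_deriv \<alpha> \<beta> \<gamma> x y - mixed_deriv \<alpha> \<beta> \<gamma> x y0) \<le> e"
  shows "X1.wnorm f1 \<alpha> q (section_deriv \<beta> \<gamma> y - section_deriv \<beta> \<gamma> y0) \<le> e"
proof (rule X1.wnorm_least[OF _ f1 \<alpha> q e])
  show "section_deriv \<beta> \<gamma> y - section_deriv \<beta> \<gamma> y0 \<in> X1.X"
    by (intro X1.wnorms.mem_X section_in_X1 \<beta> y)
  show "f1 x * q (X1.D \<alpha> (section_deriv \<beta> \<gamma> y - section_deriv \<beta> \<gamma> y0) x) \<le> e" if "x \<in> S1" for x
    using le[OF that]
    by (simp add: X1.D_diff[OF section_in_X1 section_in_X1] \<alpha> \<beta> y D_section that)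
qed

lemma continuous_map_section:
  assumes \<beta>: "mi_order \<beta> \<le> l"
  shows "continuous_map (top_of_set S2) X1.\<T> (section_deriv \<beta> \<gamma>)"
  unfolding continuous_map_atin
proof
  fix y0 assume "y0 \<in> topspace (top_of_set S2)"
  then have y0: "y0 \<in> S2" by simp
  have "((\<lambda>y. p (section_deriv \<beta> \<gamma> y - section_deriv \<beta> \<gamma> y0)) \<longlongrightarrow> 0) (at y0 within S2)"
    if p: "p \<in> X1.wnorms" for p
  proof (rule tendstoI)
    obtain f1 \<alpha> q where f1: "f1 \<in> W1" and \<alpha>: "mi_order \<alpha> \<le> k" and q: "q \<in> continuous_seminorms smul T"
      and p_eq: "p = X1.wnorm f1 \<alpha> q"
      using p unfolding X1.wnorms_def by blast
    fix e :: real assume "0 < e"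
    then have e: "0 < e / 2" by simp
    obtain B where B: "open B" "y0 \<in> B" and
      le: "\<And>y x. y \<in> S2 \<inter> B \<Longrightarrow> x \<in> S1 \<Longrightarrow> f1 x * q (mixed_deriv \<alpha> \<beta> \<gamma> x y - mixed_deriv \<alpha> \<beta> \<gamma> x y0) \<le> e / 2"
      using section_near[OF f1 \<alpha> \<beta> q y0 e] by blast
    have "dist (p (section_deriv \<beta> \<gamma> y - section_deriv \<beta> \<gamma> y0)) 0 < e" if y: "y \<in> S2 \<inter> B" for y
      using wnorm_section_diff_le[OF f1 \<alpha> \<beta> q _ y0 less_imp_le[OF e] le[OF y]] y e
      by (auto simp: p_eq X1.wnorm_nonneg)
    with B show "\<forall>\<^sub>F y in at y0 within S2. dist (p (section_deriv \<beta> \<gamma> y - section_deriv \<beta> \<gamma> y0)) 0 < e"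
      unfolding eventually_at_topological by blast
  qed
  moreover have "\<forall>\<^sub>F y in at y0 within S2. section_deriv \<beta> \<gamma> y \<in> X1.X"
    using section_in_X1[OF \<beta>] by (auto simp: eventually_at_filter)
  ultimately show "limitin X1.\<T> (section_deriv \<beta> \<gamma>) (section_deriv \<beta> \<gamma> y0) (atin (top_of_set S2) y0)"
    using y0 section_in_X1[OF \<beta>]
    by (simp add: atin_subtopology_within atin_within_euclidean X1.weighted_Ck_topology_eq
        X1.wnorms.limitin_seminorm_topology_iff)
qed

text \<open>Convergence of the difference quotients in a weighted seminorm is uniform in \<open>x\<close>. The
  mean value inequality reduces it to the uniform continuity in \<open>y\<close> of the derivative of
  next higher order, which is \<open>section_near\<close>.\<close>

lemma has_partial_deriv_section:
  assumes \<beta>: "index_list \<beta> = i # index_list \<beta>'" "mi_order \<beta> \<le> l" "mi_order \<beta>' \<le> l"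
  shows "has_partial_deriv (fun_scale smul) X1.\<T> (interior S2) i (section_deriv \<beta>' \<gamma>) (section_deriv \<beta> \<gamma>)"
  unfolding has_partial_deriv_def
proof
  fix y assume y_int: "y \<in> interior S2"
  then have y: "y \<in> S2" using interior_subset by blast
  let ?v = "axis i 1 :: (real, 'm) vec"
  let ?Q = "\<lambda>t. fun_scale smul (of_real (1 / t)) (section_deriv \<beta>' \<gamma> (y + t *\<^sub>R ?v) - section_deriv \<beta>' \<gamma> y)"
  have Q_in: "?Q t \<in> X1.X" if "y + t *\<^sub>R ?v \<in> S2" for t
    using that by (intro X1.wnorms.mem_X section_in_X1 \<beta> y)
  have shift: "\<exists>d>0. \<forall>s. \<bar>s\<bar> < d \<longrightarrow> y + s *\<^sub>R ?v \<in> B" if "open B" "y \<in> B" for B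
  proof -
    obtain d where d: "0 < d" "ball y d \<subseteq> B" by (rule openE[OF \<open>open B\<close> \<open>y \<in> B\<close>])
    have "y + s *\<^sub>R ?v \<in> ball y d" if "\<bar>s\<bar> < d" for s
      using that by (simp add: dist_norm)
    with d show ?thesis by blast
  qed
  have "((\<lambda>t. p (?Q t - section_deriv \<beta> \<gamma> y)) \<longlongrightarrow> 0) (at 0)" if p: "p \<in> X1.wnorms" for p
  proof (rule tendstoI)
    obtain f1 \<alpha> q where f1: "f1 \<in> W1" and \<alpha>: "mi_order \<alpha> \<le> k" and q: "q \<in> continuous_seminorms smul T"
      and p_eq: "p = X1.wnorm f1 \<alpha> q"
      using p unfolding X1.wnorms_def by blast
    interpret q: seminormed_subspace smul "topspace T" q by (rule seminormed_subspace_topspace[OF q])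
    fix e :: real assume "0 < e"
    then have e: "0 < e / 2" by simp
    obtain B where B: "open B" "y \<in> B" and
      le: "\<And>y' x. y' \<in> S2 \<inter> B \<Longrightarrow> x \<in> S1 \<Longrightarrow> f1 x * q (mixed_deriv \<alpha> \<beta> \<gamma> x y' - mixed_deriv \<alpha> \<beta> \<gamma> x y) \<le> e / 2"
      using section_near[OF f1 \<alpha> \<beta>(2) q y e] by blast
    obtain d where d: "0 < d" and near: "\<And>s. \<bar>s\<bar> < d \<Longrightarrow> y + s *\<^sub>R ?v \<in> interior S2 \<inter> B"
      using shift[of "interior S2 \<inter> B"] B y_int by (meson IntI open_Int open_interior)
    have "dist (p (?Q t - section_deriv \<beta> \<gamma> y)) 0 < e" if t: "t \<noteq> 0" "\<bar>t\<bar> < d" for t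
    proof -
      have yt: "y + t *\<^sub>R ?v \<in> S2" using near[OF t(2)] interior_subset by blast
      have "X1.wnorm f1 \<alpha> q (?Q t - section_deriv \<beta> \<gamma> y) \<le> e / 2"
      proof (rule X1.wnorm_least[OF X1.wnorms.mem_X(3)[OF Q_in[OF yt] section_in_X1[OF \<beta>(2) y]] f1 \<alpha> q])
        fix x assume x: "x \<in> S1"
        have eq: "X1.D \<alpha> (?Q t - section_deriv \<beta> \<gamma> y) x =
            smul (of_real (1 / t)) (mixed_deriv \<alpha> \<beta>' \<gamma> x (y + t *\<^sub>R ?v) - mixed_deriv \<alpha> \<beta>' \<gamma> x y) - mixed_deriv \<alpha> \<beta> \<gamma> x y"
          using yt y x
          by (simp add: X1.D_diff X1.D_scale_apply Q_in X1.wnorms.mem_X section_in_X1 \<alpha> \<beta>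
              D_section del: of_real_divide)
        have part: "has_partial_deriv smul T (interior S2) i (mixed_deriv \<alpha> \<beta>' \<gamma> x) (mixed_deriv \<alpha> \<beta> \<gamma> x)"
          unfolding mixed_deriv_def[abs_def]
          by (rule has_partial_deriv_multi_deriv[OF X2.dense X2.Ck_on_weighted_Ck[OF D_in_X2[OF \<alpha> x]] \<beta>])
        show "f1 x * q (X1.D \<alpha> (?Q t - section_deriv \<beta> \<gamma> y) x) \<le> e / 2"
        proof (cases "f1 x = 0")
          case False
          then have pos: "0 < f1 x" using X1.weight_nonneg[OF f1 x] by simp
          have "q (X1.D \<alpha> (?Q t - section_deriv \<beta> \<gamma> y) x) \<le> e / 2 / f1 x"
            unfolding eq
          proof (rule difference_quotient_bound[OF part q t(1)])
            show "y + s *\<^sub>R ?v \<in> interior S2" if "\<bar>s\<bar> \<le> \<bar>t\<bar>" for s using near[of s] that t by auto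
            show "mixed_deriv \<alpha> \<beta>' \<gamma> x y' \<in> topspace T" if "y' \<in> interior S2" for y'
              using that interior_subset by (intro mixed_deriv_in_topspace \<alpha> \<beta> x) auto
            show "q (mixed_deriv \<alpha> \<beta> \<gamma> x (y + s *\<^sub>R ?v) - mixed_deriv \<alpha> \<beta> \<gamma> x y) \<le> e / 2 / f1 x" if "\<bar>s\<bar> \<le> \<bar>t\<bar>" for s
              using le[of "y + s *\<^sub>R ?v" x] near[of s] that t x pos interior_subset[of S2]
              by (auto simp: pos_le_divide_eq mult.commute)
          qed
          then show ?thesis using pos by (simp add: pos_le_divide_eq mult.commute)
        qed (use e in simp)
      qed (use e in simp)
      then show ?thesis using e by (simp add: p_eq X1.wnorm_nonneg)
    qed
    with d show "\<forall>\<^sub>F t in at 0. dist (p (?Q t - section_deriv \<beta> \<gamma> y)) 0 < e"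
      unfolding eventually_at by (intro exI[of _ d]) auto
  qed
  moreover have "\<forall>\<^sub>F t in at 0. ?Q t \<in> X1.X"
    using eventually_shift_in_open[OF open_interior y_int, of ?v]
    by eventually_elim (rule Q_in, use interior_subset in blast)
  ultimately show "limitin X1.\<T> ?Q (section_deriv \<beta> \<gamma> y) (at 0)"
    using section_in_X1[OF \<beta>(2) y]
    unfolding X1.weighted_Ck_topology_eq X1.wnorms.limitin_seminorm_topology_iff by blast
qed

lemma section_zero_index: "section_deriv (\<lambda>_. 0) \<gamma> = (\<lambda>y x. \<gamma> x y)"
  by (simp add: section_deriv_def fun_eq_iff X2.D_zero_index[OF value_in_X2])

text \<open>The derivatives of the flipped map exist in the space of functions of \<open>x\<close> because they
  form a family of successive partial derivatives that starts with the flipped map itself.\<close>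

lemma flip_is_multi_deriv:
  assumes "mi_order \<beta> \<le> l"
  shows "is_multi_deriv (fun_scale smul) X1.\<T> S2 \<beta> (\<lambda>y x. \<gamma> x y) (section_deriv \<beta> \<gamma>)"
  unfolding is_multi_deriv_def
  using assms continuous_map_section has_partial_deriv_section
  by (intro conjI has_iterated_deriv_family[where l = l]) (auto simp: section_zero_index)

lemma D_flip: "mi_order \<beta> \<le> l \<Longrightarrow> y \<in> S2 \<Longrightarrow> X21.D \<beta> (\<lambda>y x. \<gamma> x y) y = section_deriv \<beta> \<gamma> y"
  using X21.multi_deriv_eq[OF X2.dense flip_is_multi_deriv] by simp

end

text \<open>An arbitrary continuous seminorm on the functions of \<open>x\<close> is dominated by finitely many
  weighted seminorms, and each of these, applied to a derivative of the flipped map, is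
  controlled by a weighted seminorm of the original map. The constant and the seminorms are the same for all maps, so the bound
  serves for membership and for continuity.\<close>

lemma section_seminorm_bound:
  assumes f2: "f2 \<in> W2" and \<beta>: "mi_order \<beta> \<le> l"
    and Q: "Q \<in> continuous_seminorms (fun_scale smul) X1.\<T>"
  obtains J :: "(((real, 'n) vec \<Rightarrow> 'e) \<Rightarrow> real) set" and pr C where
    "finite J" "pr ` J \<subseteq> X12.wnorms" "0 \<le> C"
    "\<forall>\<gamma>\<in>X12.X. \<forall>y\<in>S2. f2 y * Q (section_deriv \<beta> \<gamma> y) \<le> C * (\<Sum>j\<in>J. pr j \<gamma>)"
proof -
  obtain J C where J: "finite J" "J \<subseteq> X1.wnorms" and C: "0 \<le> C"
    and Q_le: "\<And>\<eta>. \<eta> \<in> X1.X \<Longrightarrow> Q \<eta> \<le> C * (\<Sum>p\<in>J. p \<eta>)"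
    using X1.wnorms.continuous_seminorm_bound Q unfolding X1.weighted_Ck_topology_eq by blast
  have "\<exists>p'\<in>X12.wnorms. \<forall>\<gamma>\<in>X12.X. \<forall>y\<in>S2. f2 y * p (section_deriv \<beta> \<gamma> y) \<le> p' \<gamma>"
    if p: "p \<in> J" for p
  proof -
    obtain f1 \<alpha> q where f1: "f1 \<in> W1" and \<alpha>: "mi_order \<alpha> \<le> k" and q: "q \<in> continuous_seminorms smul T"
      and p_eq: "p = X1.wnorm f1 \<alpha> q"
      using p J(2) unfolding X1.wnorms_def by blast
    show ?thesis
      unfolding p_eq
      by (intro bexI[of _ "X12.wnorm f1 \<alpha> (X2.wnorm f2 \<beta> q)"] ballI wnorm_section_bound f1 f2 \<alpha> \<beta> q
          X12.wnorms_memI X2.continuous_seminorm_wnorm)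
  qed
  then obtain pr where pr: "\<And>p. p \<in> J \<Longrightarrow> pr p \<in> X12.wnorms \<and>
      (\<forall>\<gamma>\<in>X12.X. \<forall>y\<in>S2. f2 y * p (section_deriv \<beta> \<gamma> y) \<le> pr p \<gamma>)"
    by metis
  show ?thesis
  proof (rule that[OF J(1) _ C])
    show "pr ` J \<subseteq> X12.wnorms" using pr by blast
    show "\<forall>\<gamma>\<in>X12.X. \<forall>y\<in>S2. f2 y * Q (section_deriv \<beta> \<gamma> y) \<le> C * (\<Sum>j\<in>J. pr j \<gamma>)"
    proof (intro ballI)
      fix \<gamma> y assume \<gamma>: "\<gamma> \<in> X12.X" and y: "y \<in> S2"
      have "f2 y * Q (section_deriv \<beta> \<gamma> y) \<le> f2 y * (C * (\<Sum>p\<in>J. p (section_deriv \<beta> \<gamma> y)))"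
        by (intro mult_left_mono Q_le section_in_X1 X2.weight_nonneg \<gamma> \<beta> y f2)
      also have "\<dots> = C * (\<Sum>p\<in>J. f2 y * p (section_deriv \<beta> \<gamma> y))"
        by (simp add: sum_distrib_left mult_ac)
      also have "\<dots> \<le> C * (\<Sum>p\<in>J. pr p \<gamma>)"
        using pr \<gamma> y by (intro mult_left_mono sum_mono C) blast
      finally show "f2 y * Q (section_deriv \<beta> \<gamma> y) \<le> C * (\<Sum>p\<in>J. pr p \<gamma>)" .
    qed
  qed
qed

lemma sum_wnorms_nonneg: "pr ` J \<subseteq> X12.wnorms \<Longrightarrow> 0 \<le> C \<Longrightarrow> 0 \<le> C * (\<Sum>j\<in>J. pr j \<gamma>)"
  by (intro mult_nonneg_nonneg sum_nonneg) (auto simp: X12.wnorms_def X12.wnorm_nonneg)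

lemma flip_in_X21:
  assumes \<gamma>: "\<gamma> \<in> X12.X" shows "(\<lambda>y x. \<gamma> x y) \<in> X21.X"
  unfolding X21.mem_weighted_Ck_iff
proof (intro conjI ballI allI impI)
  show "Ck_on (fun_scale smul) X1.\<T> l S2 (\<lambda>y x. \<gamma> x y)"
    using flip_is_multi_deriv[OF \<gamma>] continuous_map_section[OF \<gamma>, of "\<lambda>_. 0"]
    by (auto simp: Ck_on_def section_zero_index[OF \<gamma>] mi_order_zero)
  show "(\<lambda>x. \<gamma> x y) = 0" if "y \<notin> S2" for y
    using that X2.weighted_Ck_outside[OF value_in_X2[OF \<gamma>]] by (simp add: fun_eq_iff)
  fix f2 Q and \<beta> :: "'m \<Rightarrow> nat"
  assume f2: "f2 \<in> W2" and Q: "Q \<in> continuous_seminorms (fun_scale smul) X1.\<T>" and \<beta>: "mi_order \<beta> \<le> l"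
  obtain J :: "(((real, 'n) vec \<Rightarrow> 'e) \<Rightarrow> real) set" and pr C where "finite J" "pr ` J \<subseteq> X12.wnorms" "0 \<le> C"
    "\<forall>\<gamma>\<in>X12.X. \<forall>y\<in>S2. f2 y * Q (section_deriv \<beta> \<gamma> y) \<le> C * (\<Sum>j\<in>J. pr j \<gamma>)"
    by (rule section_seminorm_bound[OF f2 \<beta> Q])
  with \<gamma> show "\<exists>c\<ge>0. \<forall>y\<in>S2. f2 y * Q (X21.D \<beta> (\<lambda>y x. \<gamma> x y) y) \<le> c"
    using sum_wnorms_nonneg by (intro exI[of _ "C * (\<Sum>j\<in>J. pr j \<gamma>)"]) (auto simp: D_flip \<beta>)
qed

lemma continuous_map_flip: "continuous_map X12.\<T> X21.\<T> (\<lambda>\<gamma> y x. \<gamma> x y)"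
  unfolding X12.weighted_Ck_topology_eq X21.weighted_Ck_topology_eq
proof (rule continuous_map_seminorm_topologies[OF X12.wnorms.seminorm_family_axioms
      X21.wnorms.seminorm_family_axioms])
  fix r assume "r \<in> X21.wnorms"
  then obtain f2 \<beta> Q where f2: "f2 \<in> W2" and \<beta>: "mi_order \<beta> \<le> l"
    and Q: "Q \<in> continuous_seminorms (fun_scale smul) X1.\<T>" and r: "r = X21.wnorm f2 \<beta> Q"
    unfolding X21.wnorms_def by blast
  obtain J :: "(((real, 'n) vec \<Rightarrow> 'e) \<Rightarrow> real) set" and pr C where J: "finite J" "pr ` J \<subseteq> X12.wnorms"
    and C: "0 \<le> C" and
    le: "\<forall>\<gamma>\<in>X12.X. \<forall>y\<in>S2. f2 y * Q (section_deriv \<beta> \<gamma> y) \<le> C * (\<Sum>j\<in>J. pr j \<gamma>)"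
    by (rule section_seminorm_bound[OF f2 \<beta> Q])
  have "r (\<lambda>y x. \<gamma> x y) \<le> C * (\<Sum>j\<in>J. pr j \<gamma>)" if \<gamma>: "\<gamma> \<in> X12.X" for \<gamma>
    unfolding r
    by (rule X21.wnorm_least[OF flip_in_X21[OF \<gamma>] f2 \<beta> Q sum_wnorms_nonneg[OF J(2) C]])
      (use \<gamma> le in \<open>simp add: D_flip[OF \<gamma> \<beta>]\<close>)
  with J show "\<exists>(J :: (((real, 'n) vec \<Rightarrow> 'e) \<Rightarrow> real) set) pr C. finite J \<and> pr ` J \<subseteq> X12.wnorms \<and>
      (\<forall>\<gamma>\<in>X12.X. r (\<lambda>y x. \<gamma> x y) \<le> C * (\<Sum>j\<in>J. pr j \<gamma>))" by blast
qed (auto simp: flip_in_X21 fun_eq_iff)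

text \<open>The inverse is the flip for the exchanged domains.\<close>

lemma homeomorphic_map_flip: "homeomorphic_map X12.\<T> X21.\<T> (\<lambda>\<gamma> y x. \<gamma> x y)"
proof -
  interpret swap: exponential_law smul T S2 l W2 S1 k W1
    using adm1 adm2 by unfold_locales
  have "homeomorphic_maps X12.\<T> X21.\<T> (\<lambda>\<gamma> y x. \<gamma> x y) (\<lambda>\<eta> x y. \<eta> y x)"
    using continuous_map_flip swap.continuous_map_flip by (simp add: homeomorphic_maps_def)
  then show ?thesis by (rule homeomorphic_maps_imp_map)
qed

end

lemma admissible_weights_open:
  assumes "open U" and W: "set_of_weights U W" and "o_condition U W"
    and cont: "\<And>f. f \<in> W \<Longrightarrow> continuous_on U f"
  shows "admissible_weights U W"
  unfolding admissible_weights_def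
proof (intro conjI ballI allI impI)
  show "U \<subseteq> closure (interior U)" using \<open>open U\<close> closure_subset by (simp add: interior_open)
  fix x assume x: "x \<in> U"
  then obtain f where f: "f \<in> W" "0 < f x" using W unfolding set_of_weights_def by blast
  have "open {y \<in> U. f y \<in> {f x / 2<..}}"
    using continuous_open_preimage[OF cont[OF f(1)] \<open>open U\<close>, of "{f x / 2<..}"]
    by (simp add: vimage_def Int_def)
  then show "\<exists>f\<in>W. \<exists>c>0. \<exists>N. open N \<and> x \<in> N \<and> (\<forall>y\<in>U \<inter> N. c \<le> f y)"
    using f x
    by (intro bexI[of _ f] exI[of _ "f x / 2"] conjI exI[of _ "{y \<in> U. f y \<in> {f x / 2<..}}"]) auto
next
  fix f C assume "f \<in> W" "C \<subseteq> U" "compact C"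
  then have "bounded (f ` C)"
    using compact_continuous_image[of C f] continuous_on_subset cont compact_imp_bounded by blast
  then show "\<exists>b. \<forall>x\<in>C. f x \<le> b"
    by (auto simp: bounded_real dest: abs_le_D1)
qed (use assms in auto)

text \<open>On a compact domain the o-condition is trivial, as the compact set in it may be the whole
  domain.\<close>

lemma admissible_weights_compact:
  assumes "convex K" "compact K" "interior K \<noteq> {}" and W: "set_of_weights K W"
    and inf: "\<exists>h\<in>W. 0 < (INF y\<in>K. h y)" and bdd: "\<forall>h\<in>W. bounded (h ` K)"
  shows "admissible_weights K W"
  unfolding admissible_weights_def
proof (intro conjI ballI allI impI)
  show "K \<subseteq> closure (interior K)"
    using convex_closure_interior[OF \<open>convex K\<close> \<open>interior K \<noteq> {}\<close>] closure_subset by blast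
  show "o_condition K W"
    unfolding o_condition_def weight_little_o_def using \<open>compact K\<close> by blast
  fix x assume "x \<in> K"
  obtain h where h: "h \<in> W" "0 < (INF y\<in>K. h y)" using inf by blast
  have "(INF y\<in>K. h y) \<le> h y" if "y \<in> K" for y
    using bdd h(1) that by (intro cINF_lower bounded_imp_bdd_below) auto
  with h show "\<exists>f\<in>W. \<exists>c>0. \<exists>N. open N \<and> x \<in> N \<and> (\<forall>y\<in>K \<inter> N. c \<le> f y)"
    by (intro bexI[of _ h] exI[of _ "INF y\<in>K. h y"] conjI exI[of _ UNIV]) auto
next
  fix f C assume "f \<in> W" "C \<subseteq> K"
  then show "\<exists>b. \<forall>x\<in>C. f x \<le> b"
    using bdd by (fastforce simp: bounded_real dest: abs_le_D1)
qed (rule W)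

lemma linear_flip:
  assumes "vector_space smul"
  shows "Vector_Spaces.linear (fun_scale (fun_scale smul)) (fun_scale (fun_scale smul))
    (\<lambda>(\<gamma> :: 'a \<Rightarrow> 'b \<Rightarrow> 'e::ab_group_add) y x. \<gamma> x y)"
proof -
  note vs = vector_space_fun_scale[OF vector_space_fun_scale[OF assms]]
  interpret V: vector_space_pair "fun_scale (fun_scale smul) :: _ \<Rightarrow> ('a \<Rightarrow> 'b \<Rightarrow> _) \<Rightarrow> _"
      "fun_scale (fun_scale smul) :: _ \<Rightarrow> ('b \<Rightarrow> 'a \<Rightarrow> _) \<Rightarrow> _"
    by (rule vector_space_pair.intro[OF vs vs])
  show ?thesis
    by unfold_locales (simp_all add: fun_eq_iff fun_scale_def)
qed

theorem corollary3p41: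
  fixes smul :: "'k::real_normed_field \<Rightarrow> 'e::ab_group_add \<Rightarrow> 'e"
    and E :: "'e topology"
    and U :: "(real, 'n::{finite,linorder}) vec set"
    and K :: "(real, 'm::{finite,linorder}) vec set"
    and k l :: enat
    and W1 :: "((real, 'n) vec \<Rightarrow> real) set"
    and W2 :: "((real, 'm) vec \<Rightarrow> real) set"
  assumes "locally_convex_space smul E" and "Hausdorff_space E"
    and "open U"
    and "convex K" and "compact K" and "interior K \<noteq> {}"
    and "set_of_weights U W1" and "\<forall>f\<in>W1. Ck_on (*) euclideanreal k U f"
    and "o_condition U W1"
    and "\<forall>f\<in>W1. \<forall>\<alpha>. mi_order \<alpha> \<le> k \<longrightarrow>
           (\<exists>g\<in>W1. \<forall>x\<in>U. \<bar>multi_deriv (*) euclideanreal U \<alpha> f x\<bar> \<le> g x)"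
    and "set_of_weights K W2"
    and "\<exists>h\<in>W2. 0 < (INF y\<in>K. h y)"
    and "\<forall>h\<in>W2. bounded (h ` K)"
  shows "Vector_Spaces.linear (fun_scale (fun_scale smul)) (fun_scale (fun_scale smul))
           (\<lambda>(\<gamma> :: (real, 'n) vec \<Rightarrow> (real, 'm) vec \<Rightarrow> 'e) y x. \<gamma> x y) \<and>
         homeomorphic_map
           (weighted_Ck_topology (fun_scale smul) (weighted_Ck_topology smul E l K W2) k U W1)
           (weighted_Ck_topology (fun_scale smul) (weighted_Ck_topology smul E k U W1) l K W2)
           (\<lambda>\<gamma> y x. \<gamma> x y)"
proof
  interpret E: hausdorff_locally_convex_space smul E
    using assms(1,2) by (simp add: hausdorff_locally_convex_space_def hausdorff_locally_convex_space_axioms_def)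
  show "Vector_Spaces.linear (fun_scale (fun_scale smul)) (fun_scale (fun_scale smul))
      (\<lambda>(\<gamma> :: (real, 'n) vec \<Rightarrow> (real, 'm) vec \<Rightarrow> 'e) y x. \<gamma> x y)"
    by (rule linear_flip[OF E.vector_space_axioms])
  have "continuous_on U f" if "f \<in> W1" for f
    using assms(8) that by (auto simp: Ck_on_def)
  then interpret exponential_law smul E U k W1 K l W2
    using assms by unfold_locales (intro admissible_weights_open admissible_weights_compact; simp)+
  show "homeomorphic_map
      (weighted_Ck_topology (fun_scale smul) (weighted_Ck_topology smul E l K W2) k U W1)
      (weighted_Ck_topology (fun_scale smul) (weighted_Ck_topology smul E k U W1) l K W2)
      (\<lambda>\<gamma> y x. \<gamma> x y)"
    by (rule homeomorphic_map_flip)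
qed

end
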